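(* Let $0<r<1$ and let $n\ge 2$ be an integer. The multiplication operator $M_{z^n}:L^2_a(A_r)\to L^2_a(A_r)$, $M_{z^n}f=z^nf$, has exactly $2^n$ reducing subspaces, and its minimal reducing subspaces are $\mathcal{S}_0,\dots,\mathcal{S}_{n-1}$.
   Context: $A_r=\{z\in\mathbb{C}: r<|z|<1\}$. $L^2(A_r)$ is the $L^2$-space of planar Lebesgue measure on $A_r$, and the Bergman space $L^2_a(A_r)$ is the closure in $L^2(A_r)$ of the space $R(A_r)$ of rational functions with poles outside the closure of $A_r$. For $0\le k<n$, $\mathcal{S}_k$ is the closed subspace of $L^2_a(A_r)$ generated by the functions $z^m$, $m\in\mathbb{Z}$, $m\equiv k \pmod n$. A reducing subspace of an operator $T$ is a closed subspace invariant under both $T$ and $T^*$ (the zero subspace and the whole space are counted); a minimal reducing subspace is a nonzero reducing subspace containing no reducing subspace other than $\{0\}$ and itself. *)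

theory Defs
  imports "HOL-Analysis.Analysis" "HOL-Computational_Algebra.Polynomial" "HOL-Number_Theory.Cong"
begin

section \<open>The complex Hilbert space $L^2$ of a measure\<close>

text \<open>
  Elements of \<open>L2 M\<close> are equivalence classes of square-integrable complex functions
  modulo equality almost everywhere. The Hilbert space operations are defined on an arbitrary
  representative; the lemmas below show that the choice does not matter.
\<close>

definition square_integrable :: "'a measure \<Rightarrow> ('a \<Rightarrow> complex) set" where
  "square_integrable M = {f \<in> borel_measurable M. integrable M (\<lambda>x. (cmod (f x))\<^sup>2)}"

type_synonym 'a l2 = "('a \<Rightarrow> complex) set"

definition ae_class :: "'a measure \<Rightarrow> ('a \<Rightarrow> complex) \<Rightarrow> 'a l2" where
  "ae_class M f = {g \<in> square_integrable M. AE x in M. g x = f x}"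

definition L2 :: "'a measure \<Rightarrow> 'a l2 set" where
  "L2 M = ae_class M ` square_integrable M"

definition l2_rep :: "'a l2 \<Rightarrow> 'a \<Rightarrow> complex" where
  "l2_rep F = (SOME f. f \<in> F)"

definition l2_zero :: "'a measure \<Rightarrow> 'a l2" where
  "l2_zero M = ae_class M (\<lambda>x. 0)"

definition l2_add :: "'a measure \<Rightarrow> 'a l2 \<Rightarrow> 'a l2 \<Rightarrow> 'a l2" where
  "l2_add M F G = ae_class M (\<lambda>x. l2_rep F x + l2_rep G x)"

definition l2_scale :: "'a measure \<Rightarrow> complex \<Rightarrow> 'a l2 \<Rightarrow> 'a l2" where
  "l2_scale M c F = ae_class M (\<lambda>x. c * l2_rep F x)"

definition l2_inner :: "'a measure \<Rightarrow> 'a l2 \<Rightarrow> 'a l2 \<Rightarrow> complex" where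
  "l2_inner M F G = (LINT x|M. l2_rep F x * cnj (l2_rep G x))"

definition l2_dist :: "'a measure \<Rightarrow> 'a l2 \<Rightarrow> 'a l2 \<Rightarrow> real" where
  "l2_dist M F G = sqrt (LINT x|M. (cmod (l2_rep F x - l2_rep G x))\<^sup>2)"

definition l2_mult :: "'a measure \<Rightarrow> ('a \<Rightarrow> complex) \<Rightarrow> 'a l2 \<Rightarrow> 'a l2" where
  "l2_mult M \<phi> F = ae_class M (\<lambda>x. \<phi> x * l2_rep F x)"

subsection \<open>Independence of representatives\<close>

lemma ae_class_self: "f \<in> square_integrable M \<Longrightarrow> f \<in> ae_class M f"
  by (simp add: ae_class_def)

lemma ae_class_cong:
  assumes "AE x in M. f x = g x"
  shows "ae_class M f = ae_class M g"
proof -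
  have "(AE x in M. h x = f x) \<longleftrightarrow> (AE x in M. h x = g x)" for h
    using assms by (intro iffI; elim AE_mp) (auto elim!: AE_mp)
  then show ?thesis by (simp add: ae_class_def)
qed

lemma ae_class_eq_iff:
  assumes "f \<in> square_integrable M"
  shows "ae_class M f = ae_class M g \<longleftrightarrow> (AE x in M. f x = g x)"
  using ae_class_self[OF assms] ae_class_cong[of f g M] by (auto simp: ae_class_def)

lemma l2_rep_ae_class:
  assumes "f \<in> square_integrable M"
  shows "l2_rep (ae_class M f) \<in> square_integrable M"
    and "AE x in M. l2_rep (ae_class M f) x = f x"
proof -
  have "l2_rep (ae_class M f) \<in> ae_class M f"
    unfolding l2_rep_def by (rule someI[of "\<lambda>h. h \<in> ae_class M f", OF ae_class_self[OF assms]])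
  then show "l2_rep (ae_class M f) \<in> square_integrable M"
    and "AE x in M. l2_rep (ae_class M f) x = f x"
    by (simp_all add: ae_class_def)
qed

lemma l2_add_ae_class:
  assumes "f \<in> square_integrable M" "g \<in> square_integrable M"
  shows "l2_add M (ae_class M f) (ae_class M g) = ae_class M (\<lambda>x. f x + g x)"
  unfolding l2_add_def
  using l2_rep_ae_class(2)[OF assms(1)] l2_rep_ae_class(2)[OF assms(2)]
  by (intro ae_class_cong) (elim AE_mp, auto)

lemma l2_scale_ae_class:
  assumes "f \<in> square_integrable M"
  shows "l2_scale M c (ae_class M f) = ae_class M (\<lambda>x. c * f x)"
  unfolding l2_scale_def
  using l2_rep_ae_class(2)[OF assms]
  by (intro ae_class_cong) (elim AE_mp, auto)

lemma l2_mult_ae_class: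
  assumes "f \<in> square_integrable M"
  shows "l2_mult M \<phi> (ae_class M f) = ae_class M (\<lambda>x. \<phi> x * f x)"
  unfolding l2_mult_def
  using l2_rep_ae_class(2)[OF assms]
  by (intro ae_class_cong) (elim AE_mp, auto)

lemma l2_inner_ae_class:
  assumes "f \<in> square_integrable M" "g \<in> square_integrable M"
  shows "l2_inner M (ae_class M f) (ae_class M g) = (LINT x|M. f x * cnj (g x))"
proof -
  have [measurable]: "f \<in> borel_measurable M" "g \<in> borel_measurable M"
    "l2_rep (ae_class M f) \<in> borel_measurable M" "l2_rep (ae_class M g) \<in> borel_measurable M"
    using assms l2_rep_ae_class(1)[OF assms(1)] l2_rep_ae_class(1)[OF assms(2)]
    by (auto simp: square_integrable_def)
  have [measurable]: "cnj \<in> borel_measurable borel"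
    by (intro borel_measurable_continuous_onI continuous_intros)
  show ?thesis
    unfolding l2_inner_def
    using l2_rep_ae_class(2)[OF assms(1)] l2_rep_ae_class(2)[OF assms(2)]
    by (intro integral_cong_AE) (auto elim!: AE_mp)
qed

lemma l2_dist_ae_class:
  assumes "f \<in> square_integrable M" "g \<in> square_integrable M"
  shows "l2_dist M (ae_class M f) (ae_class M g) = sqrt (LINT x|M. (cmod (f x - g x))\<^sup>2)"
proof -
  have [measurable]: "f \<in> borel_measurable M" "g \<in> borel_measurable M"
    "l2_rep (ae_class M f) \<in> borel_measurable M" "l2_rep (ae_class M g) \<in> borel_measurable M"
    using assms l2_rep_ae_class(1)[OF assms(1)] l2_rep_ae_class(1)[OF assms(2)]
    by (auto simp: square_integrable_def)
  have "(LINT x|M. (cmod (l2_rep (ae_class M f) x - l2_rep (ae_class M g) x))\<^sup>2)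
      = (LINT x|M. (cmod (f x - g x))\<^sup>2)"
    using l2_rep_ae_class(2)[OF assms(1)] l2_rep_ae_class(2)[OF assms(2)]
    by (intro integral_cong_AE) (auto elim!: AE_mp)
  then show ?thesis by (simp add: l2_dist_def)
qed

section \<open>Closed subspaces and reducing subspaces\<close>

definition l2_closure :: "'a measure \<Rightarrow> 'a l2 set \<Rightarrow> 'a l2 set" where
  "l2_closure M S = {F \<in> L2 M. \<forall>e>0. \<exists>G\<in>S. l2_dist M F G < e}"

definition l2_closed_subspace :: "'a measure \<Rightarrow> 'a l2 set \<Rightarrow> bool" where
  "l2_closed_subspace M S \<longleftrightarrow>
     S \<subseteq> L2 M \<and> l2_zero M \<in> S \<and>
     (\<forall>F\<in>S. \<forall>G\<in>S. l2_add M F G \<in> S) \<and>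
     (\<forall>c. \<forall>F\<in>S. l2_scale M c F \<in> S) \<and>
     l2_closure M S = S"

text \<open>
  The adjoint of an operator \<open>T\<close> on the Hilbert space \<open>H\<close>, a closed subspace of \<open>L2 M\<close>.
\<close>

definition l2_adjoint :: "'a measure \<Rightarrow> 'a l2 set \<Rightarrow> ('a l2 \<Rightarrow> 'a l2) \<Rightarrow> 'a l2 \<Rightarrow> 'a l2" where
  "l2_adjoint M H T G = (THE K. K \<in> H \<and> (\<forall>F\<in>H. l2_inner M (T F) G = l2_inner M F K))"

definition reducing_subspace :: "'a measure \<Rightarrow> 'a l2 set \<Rightarrow> ('a l2 \<Rightarrow> 'a l2) \<Rightarrow> 'a l2 set \<Rightarrow> bool" where
  "reducing_subspace M H T S \<longleftrightarrow>
     l2_closed_subspace M S \<and> S \<subseteq> H \<and>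
     (\<forall>F\<in>S. T F \<in> S) \<and> (\<forall>F\<in>S. l2_adjoint M H T F \<in> S)"

definition minimal_reducing_subspace ::
    "'a measure \<Rightarrow> 'a l2 set \<Rightarrow> ('a l2 \<Rightarrow> 'a l2) \<Rightarrow> 'a l2 set \<Rightarrow> bool" where
  "minimal_reducing_subspace M H T S \<longleftrightarrow>
     reducing_subspace M H T S \<and> S \<noteq> {l2_zero M} \<and>
     (\<forall>S'. reducing_subspace M H T S' \<and> S' \<subseteq> S \<longrightarrow> S' = {l2_zero M} \<or> S' = S)"

section \<open>The Bergman space of an annulus\<close>

definition annulus :: "real \<Rightarrow> complex set" where
  "annulus r = {z. r < cmod z \<and> cmod z < 1}"

abbreviation annulus_measure :: "real \<Rightarrow> complex measure" where
  "annulus_measure r \<equiv> lebesgue_on (annulus r)"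

text \<open>
  A rational function has its poles outside a set iff it can be written as a quotient of
  polynomials whose denominator has no zero in that set.
\<close>

definition rational_functions :: "complex set \<Rightarrow> (complex \<Rightarrow> complex) set" where
  "rational_functions K = {\<lambda>z. poly p z / poly q z |p q. \<forall>z\<in>K. poly q z \<noteq> 0}"

definition bergman_space :: "real \<Rightarrow> complex l2 set" where
  "bergman_space r = l2_closure (annulus_measure r)
     (ae_class (annulus_measure r) ` rational_functions (closure (annulus r)))"

definition mult_pow :: "real \<Rightarrow> nat \<Rightarrow> complex l2 \<Rightarrow> complex l2" where
  "mult_pow r n = l2_mult (annulus_measure r) (\<lambda>z. z ^ n)"

definition residue_subspace :: "real \<Rightarrow> nat \<Rightarrow> nat \<Rightarrow> complex l2 set" where
  "residue_subspace r n k = l2_closed_subspace (annulus_measure r) hull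
     {ae_class (annulus_measure r) (\<lambda>z. z powi m) |m :: int. [m = int k] (mod int n)}"

end

theory Submission
  imports Defs "HOL-Computational_Algebra.Fundamental_Theorem_Algebra"
begin

text \<open>
  Let \<open>\<omega> j\<close> be the squared norm of \<open>z\<^sup>j\<close> on the annulus. Area measure is invariant under rotations, so the
  monomials \<open>z\<^sup>j\<close>, \<open>j \<in> \<int>\<close>, are orthogonal. A rational function without poles on the closed annulus is there
  a uniform limit of Laurent polynomials, so the monomials span the Bergman space. An element \<open>F\<close> is
  therefore the same thing as its family of Laurent coefficients \<open>a\<^sub>j\<close>, subject only to
  \<open>\<Sum>j. \<bar>a\<^sub>j\<bar>\<^sup>2 \<omega> j < \<infinity>\<close> (\<open>parseval\<close>, \<open>riesz_fischer\<close>). In these coordinates \<open>T\<close>, multiplication by \<open>z\<^sup>n\<close>,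
  shifts indices by \<open>n\<close>, its adjoint \<open>T\<^sup>*\<close> shifts back with weights, and \<open>T\<^sup>* T\<close> is diagonal with
  eigenvalues \<open>\<lambda> j = \<omega> (j + n) / \<omega> j\<close>.

  The decisive fact is that \<open>\<lambda>\<close> is strictly increasing (\<open>eigval_less\<close>): the moments \<open>\<omega> j\<close> of the radius
  are strictly log-convex. So \<open>T\<^sup>* T\<close> tells all monomials apart. Let \<open>S\<close> be reducing and let \<open>F\<close> in \<open>S\<close> have
  \<open>a\<^sub>m \<noteq> 0\<close>. The operator \<open>B = 1 - (T\<^sup>* T - \<lambda> m)\<^sup>2\<close> maps \<open>S\<close> into itself, fixes \<open>z\<^sup>m\<close>, and multiplies every other
  \<open>z\<^sup>j\<close> by a factor in \<open>(0, 1)\<close>. Hence \<open>B\<^sup>N F\<close> tends to \<open>a\<^sub>m z\<^sup>m\<close>, and \<open>z\<^sup>m\<close> lies in \<open>S\<close>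
  (\<open>reducing_contains_monomial\<close>). So \<open>S\<close> is the closed span of the monomials in it. As \<open>T\<close> and \<open>T\<^sup>*\<close> carry
  \<open>z\<^sup>m\<close> to nonzero multiples of its translates by \<open>n\<close> in the exponent, the set of these exponents is
  \<open>n\<close>-periodic, and conversely every periodic set of exponents gives a reducing subspace.

  Periodic sets are the unions of residue classes modulo \<open>n\<close>. Distinct sets have distinct spans, so there
  are \<open>2 ^ n\<close> reducing subspaces, ordered like the subsets of \<open>{0..<n}\<close>; the minimal ones belong to the
  singletons.
\<close>

section \<open>Rotation invariance of Lebesgue measure in the plane\<close>

text \<open>
  Identifying the plane with \<open>real^2\<close> turns multiplication by a unimodular number into an orthogonal
  transformation, and those preserve the measure of measurable sets.
\<close>

lemma lborel_complex_eq_distr: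
  "(lborel :: complex measure) = distr (lborel :: (real^2) measure) borel (\<lambda>x. Complex (x$1) (x$2))"
proof (rule lborel_eqI)
  have cont: "continuous_on UNIV (\<lambda>x::real^2. Complex (x$1) (x$2))"
    unfolding Complex_eq by (intro continuous_intros)
  have meas [measurable]: "(\<lambda>x::real^2. Complex (x$1) (x$2)) \<in> borel_measurable borel"
    by (intro borel_measurable_continuous_onI cont)
  fix l u :: complex
  assume le: "\<And>b. b \<in> Basis \<Longrightarrow> l \<bullet> b \<le> u \<bullet> b"
  let ?v = "\<lambda>z. vector [Re z, Im z] :: real^2"
  have 1: "(\<lambda>x::real^2. Complex (x$1) (x$2)) -` box l u = box (?v l) (?v u)"
    by (auto simp: box_def Basis_complex_def inner_axis forall_2 Basis_vec_def inner_complex_def)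
  have "\<And>b. b \<in> Basis \<Longrightarrow> ?v l \<bullet> b \<le> ?v u \<bullet> b"
  proof -
    have "\<forall>i. ?v l $ i \<le> ?v u $ i"
      using le[of 1] le[of \<i>] by (simp add: forall_2 Basis_complex_def inner_complex_def)
    then show "?v l \<bullet> b \<le> ?v u \<bullet> b" if "b \<in> Basis" for b
      using that by (auto simp: Basis_vec_def inner_axis)
  qed
  then have "emeasure lborel (box (?v l) (?v u)) = ennreal (\<Prod>b\<in>Basis. (?v u - ?v l) \<bullet> b)"
    by (simp add: emeasure_lborel_box_eq)
  also have "(\<Prod>b\<in>Basis. (?v u - ?v l) \<bullet> b) = (Re u - Re l) * (Im u - Im l)"
    by (simp add: Basis_vec_def UNION_singleton_eq_range UNIV_2 axis_eq_axis inner_axis)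
  also have "\<dots> = (\<Prod>b\<in>Basis. (u - l) \<bullet> b)"
    by (simp add: Basis_complex_def inner_complex_def)
  finally show "emeasure (distr lborel borel (\<lambda>x::real^2. Complex (x$1) (x$2))) (box l u)
      = (\<Prod>b\<in>Basis. (u - l) \<bullet> b)"
    by (simp add: emeasure_distr 1)
qed simp

lemma lborel_distr_orthogonal:
  fixes f :: "real^2 \<Rightarrow> real^2"
  assumes f: "orthogonal_transformation f"
  shows "distr lborel borel f = lborel"
proof (rule lborel_eqI[symmetric])
  have lin: "linear f" using f by (rule orthogonal_transformation_linear)
  have [measurable]: "f \<in> borel_measurable borel"
    by (intro borel_measurable_continuous_onI linear_continuous_on linear_conv_bounded_linear[THEN iffD1] lin)
  fix l u :: "real^2"
  assume le: "\<And>b. b \<in> Basis \<Longrightarrow> l \<bullet> b \<le> u \<bullet> b"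
  have g: "orthogonal_transformation (inv f)" using f by (rule orthogonal_transformation_inv)
  have bij: "bij f" using f by (rule orthogonal_transformation_bij)
  have eq: "f -` box l u = inv f ` box l u" using bij by (rule bij_vimage_eq_inv_image)
  have b: "box l u \<in> lmeasurable" by simp
  have "emeasure lborel (f -` box l u) = emeasure lebesgue (f -` box l u)" 
    using measurable_sets[of f borel borel "box l u"] by simp
  also have "\<dots> = emeasure lebesgue (box l u)"
    unfolding eq
    by (simp only: emeasure_eq_measure2 b measure_orthogonal_image[OF g b] measurable_orthogonal_image[OF g b])
  also have "\<dots> = (\<Prod>b\<in>Basis. (u - l) \<bullet> b)"
    using le by (simp add: emeasure_lborel_box_eq)
  finally show "emeasure (distr lborel borel f) (box l u) = (\<Prod>b\<in>Basis. (u - l) \<bullet> b)"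
    by (simp add: emeasure_distr)
qed simp

lemma lborel_distr_rotation:
  assumes w: "cmod w = 1"
  shows "distr lborel borel (\<lambda>z. w * z) = (lborel :: complex measure)"
proof -
  let ?C = "\<lambda>x::real^2. Complex (x$1) (x$2)"
  let ?f = "\<lambda>x::real^2. vector [Re (w * ?C x), Im (w * ?C x)] :: real^2"
  have "continuous_on UNIV ?C"
    unfolding Complex_eq by (intro continuous_intros)
  then have [measurable]: "?C \<in> borel_measurable borel"
    by (intro borel_measurable_continuous_onI)
  have fun_norm: "norm x = cmod (?C x)" for x
    by (simp add: norm_vec_def L2_set_def UNIV_2 cmod_def)
  have lin: "linear ?f"
    by (rule linearI; simp add: vec_eq_iff forall_2 algebra_simps)
  have f: "orthogonal_transformation ?f"
    unfolding orthogonal_transformation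
  proof (intro conjI allI lin)
    fix x
    have "?C (?f x) = w * ?C x" by (simp add: complex_eq_iff)
    then show "norm (?f x) = norm x" by (simp only: fun_norm norm_mult w mult_1)
  qed
  have [measurable]: "?f \<in> borel_measurable borel"
    by (intro borel_measurable_continuous_onI linear_continuous_on linear_conv_bounded_linear[THEN iffD1] lin)
  have eq: "?C \<circ> ?f = (\<lambda>x. w * ?C x)"
    by (simp add: fun_eq_iff complex_eq_iff)
  have "distr lborel borel (\<lambda>z. w * z) = distr (distr lborel borel ?C) borel (\<lambda>z. w * z)"
    by (simp flip: lborel_complex_eq_distr)
  also have "\<dots> = distr lborel borel (\<lambda>x. w * ?C x)"
    by (subst distr_distr) (auto simp: o_def)
  also have "(\<lambda>x. w * ?C x) = ?C \<circ> ?f"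
    by (rule eq[symmetric])
  also have "distr lborel borel (?C \<circ> ?f) = distr (distr lborel borel ?f) borel ?C"
    by (rule distr_distr[symmetric]) measurable
  also have "\<dots> = lborel"
    by (simp only: lborel_distr_orthogonal[OF f] lborel_complex_eq_distr[symmetric])
  finally show ?thesis .
qed

section \<open>Square-integrable functions\<close>

text \<open>
  The inner product and the norm act on representatives, so that sums and products can be written
  pointwise; classes come in only once the analysis is done.
\<close>

definition fun_inner :: "'a measure \<Rightarrow> ('a \<Rightarrow> complex) \<Rightarrow> ('a \<Rightarrow> complex) \<Rightarrow> complex" where
  "fun_inner M f g = (LINT x|M. f x * cnj (g x))"

definition fun_norm :: "'a measure \<Rightarrow> ('a \<Rightarrow> complex) \<Rightarrow> real" where
  "fun_norm M f = sqrt (LINT x|M. (cmod (f x))\<^sup>2)"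

lemma borel_measurable_cnj [measurable]: "cnj \<in> borel_measurable borel"
  by (intro borel_measurable_continuous_onI continuous_intros)

lemma square_integrableD [measurable_dest]:
  "f \<in> square_integrable M \<Longrightarrow> f \<in> borel_measurable M"
  by (simp add: square_integrable_def)

lemma square_integrable_zero [simp]: "(\<lambda>x. 0) \<in> square_integrable M"
  by (simp add: square_integrable_def)

lemma square_integrable_scale:
  "f \<in> square_integrable M \<Longrightarrow> (\<lambda>x. c * f x) \<in> square_integrable M"
  by (auto simp: square_integrable_def norm_mult power_mult_distrib)

lemma square_integrable_add:
  assumes f: "f \<in> square_integrable M" and g: "g \<in> square_integrable M"
  shows "(\<lambda>x. f x + g x) \<in> square_integrable M"
proof -
  have [measurable]: "f \<in> borel_measurable M" "g \<in> borel_measurable M"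
    using f g by auto
  have "integrable M (\<lambda>x. 2 * (cmod (f x))\<^sup>2 + 2 * (cmod (g x))\<^sup>2)"
    using f g by (auto simp: square_integrable_def)
  moreover have "(cmod (a + b))\<^sup>2 \<le> 2 * (cmod a)\<^sup>2 + 2 * (cmod b)\<^sup>2" for a b :: complex
  proof -
    have "(cmod (a + b))\<^sup>2 \<le> (cmod a + cmod b)\<^sup>2"
      by (intro power_mono norm_triangle_ineq) auto
    also have "\<dots> \<le> 2 * (cmod a)\<^sup>2 + 2 * (cmod b)\<^sup>2"
      using sum_squares_bound[of "cmod a" "cmod b"] by (simp add: power2_sum)
    finally show ?thesis .
  qed
  ultimately have "integrable M (\<lambda>x. (cmod (f x + g x))\<^sup>2)"
    by (elim Bochner_Integration.integrable_bound) (auto intro: order_trans[OF _ abs_ge_self])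
  then show ?thesis by (simp add: square_integrable_def)
qed

lemma square_integrable_diff:
  assumes "f \<in> square_integrable M" "g \<in> square_integrable M"
  shows "(\<lambda>x. f x - g x) \<in> square_integrable M"
  using square_integrable_add[OF assms(1) square_integrable_scale[OF assms(2), of "-1"]] by simp

lemma square_integrable_mult_bounded:
  assumes f: "f \<in> square_integrable M" and h [measurable]: "h \<in> borel_measurable M"
    and B: "\<And>x. x \<in> space M \<Longrightarrow> cmod (h x) \<le> B"
  shows "(\<lambda>x. h x * f x) \<in> square_integrable M"
proof -
  have [measurable]: "f \<in> borel_measurable M" using f by auto
  have "integrable M (\<lambda>x. B\<^sup>2 * (cmod (f x))\<^sup>2)"
    using f by (simp add: square_integrable_def)
  moreover have "(cmod (h x * f x))\<^sup>2 \<le> B\<^sup>2 * (cmod (f x))\<^sup>2" if "x \<in> space M" for x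
    using B[OF that] by (auto simp: norm_mult power_mult_distrib intro!: mult_right_mono power_mono)
  ultimately have "integrable M (\<lambda>x. (cmod (h x * f x))\<^sup>2)"
    by (elim Bochner_Integration.integrable_bound) (auto intro: order_trans[OF _ abs_ge_self])
  then show ?thesis by (simp add: square_integrable_def)
qed

lemma integrable_mult_cnj:
  assumes f: "f \<in> square_integrable M" and g: "g \<in> square_integrable M"
  shows "integrable M (\<lambda>x. f x * cnj (g x))"
proof -
  have [measurable]: "f \<in> borel_measurable M" "g \<in> borel_measurable M"
    using f g by auto
  have "integrable M (\<lambda>x. (cmod (f x))\<^sup>2 + (cmod (g x))\<^sup>2)"
    using f g by (auto simp: square_integrable_def)
  then show ?thesis
  proof (rule Bochner_Integration.integrable_bound)
    have "cmod (f x * cnj (g x)) \<le> (cmod (f x))\<^sup>2 + (cmod (g x))\<^sup>2" for x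
    proof -
      have "0 \<le> cmod (f x) * cmod (g x)" by simp
      then show ?thesis
        using sum_squares_bound[of "cmod (f x)" "cmod (g x)"]
        unfolding norm_mult complex_mod_cnj by linarith
    qed
    then show "AE x in M. norm (f x * cnj (g x)) \<le> norm ((cmod (f x))\<^sup>2 + (cmod (g x))\<^sup>2)"
      by (auto intro: order_trans[OF _ abs_ge_self])
  qed measurable
qed

lemma fun_inner_add_left:
  assumes "f \<in> square_integrable M" "g \<in> square_integrable M" "h \<in> square_integrable M"
  shows "fun_inner M (\<lambda>x. f x + g x) h = fun_inner M f h + fun_inner M g h"
  using assms by (simp add: fun_inner_def distrib_right integrable_mult_cnj)

lemma fun_inner_scale_left: "fun_inner M (\<lambda>x. c * f x) h = c * fun_inner M f h"
  by (simp add: fun_inner_def mult.assoc)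

lemma cnj_fun_inner: "cnj (fun_inner M f g) = fun_inner M g f"
  unfolding fun_inner_def by (subst Bochner_Integration.integral_cnj[symmetric]) (simp add: mult.commute del: Bochner_Integration.integral_cnj)

lemma fun_norm_nonneg [simp]: "fun_norm M f \<ge> 0" by (simp add: fun_norm_def)

lemma fun_norm_square: "(fun_norm M f)\<^sup>2 = (LINT x|M. (cmod (f x))\<^sup>2)"
  by (simp add: fun_norm_def)

lemma fun_inner_self: "fun_inner M f f = of_real ((fun_norm M f)\<^sup>2)"
  unfolding fun_inner_def fun_norm_square
  by (subst integral_complex_of_real[symmetric]) (simp only: complex_norm_square)

lemma fun_inner_diff_left:
  assumes "f \<in> square_integrable M" "g \<in> square_integrable M" "h \<in> square_integrable M"
  shows "fun_inner M (\<lambda>x. f x - g x) h = fun_inner M f h - fun_inner M g h"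
  using assms by (simp add: fun_inner_def left_diff_distrib integrable_mult_cnj)

lemma fun_inner_sum_left:
  assumes "\<And>i. i \<in> A \<Longrightarrow> f i \<in> square_integrable M" "h \<in> square_integrable M"
  shows "fun_inner M (\<lambda>x. \<Sum>i\<in>A. f i x) h = (\<Sum>i\<in>A. fun_inner M (f i) h)"
  using assms by (simp add: fun_inner_def sum_distrib_right integrable_mult_cnj)

lemma fun_norm_square_diff:
  assumes "f \<in> square_integrable M" "g \<in> square_integrable M"
  shows "(fun_norm M (\<lambda>x. f x - g x))\<^sup>2 = (fun_norm M f)\<^sup>2 - 2 * Re (fun_inner M f g) + (fun_norm M g)\<^sup>2"
proof -
  note fg = square_integrable_diff[OF assms]
  have "fun_inner M (\<lambda>x. f x - g x) (\<lambda>x. f x - g x) = fun_inner M f (\<lambda>x. f x - g x) - fun_inner M g (\<lambda>x. f x - g x)"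
    by (rule fun_inner_diff_left[OF assms fg])
  also have "\<dots> = cnj (fun_inner M (\<lambda>x. f x - g x) f) - cnj (fun_inner M (\<lambda>x. f x - g x) g)"
    by (simp add: cnj_fun_inner)
  also have "\<dots> = fun_inner M f f - fun_inner M f g - (fun_inner M g f - fun_inner M g g)"
    using assms by (simp add: fun_inner_diff_left cnj_fun_inner)
  finally have "Re (fun_inner M (\<lambda>x. f x - g x) (\<lambda>x. f x - g x)) = Re \<dots>" by simp
  moreover have "Re (fun_inner M g f) = Re (fun_inner M f g)"
    using cnj_fun_inner[of M f g] by (metis complex_cnj(1) complex.sel(1) cnj.sel(1))
  ultimately show ?thesis by (simp add: fun_inner_self)
qed

text \<open>
  The Cauchy-Schwarz inequality, with absolute values inside the integral; the same form with \<open>g = 1\<close>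
  compares the \<open>L\<^sup>1\<close> with the \<open>L\<^sup>2\<close> norm on a finite measure.
\<close>

lemma integral_cmod_mult_le:
  assumes f: "f \<in> square_integrable M" and g: "g \<in> square_integrable M"
  shows "(LINT x|M. cmod (f x) * cmod (g x)) \<le> fun_norm M f * fun_norm M g"
proof -
  have [measurable]: "f \<in> borel_measurable M" "g \<in> borel_measurable M"
    using f g by auto
  have int: "integrable M (\<lambda>x. cmod (f x) * cmod (g x))"
    using integrable_norm[OF integrable_mult_cnj[OF f g]] by (simp add: norm_mult)
  define I where "I = (LINT x|M. cmod (f x) * cmod (g x))"
  have I0: "I \<ge> 0" by (simp add: I_def)
  have "(\<integral>\<^sup>+x. ennreal (cmod (f x)) * ennreal (cmod (g x)) \<partial>M)\<^sup>2
      \<le> (\<integral>\<^sup>+x. (ennreal (cmod (f x)))\<^sup>2 \<partial>M) * (\<integral>\<^sup>+x. (ennreal (cmod (g x)))\<^sup>2 \<partial>M)"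
    by (rule Cauchy_Schwarz_nn_integral) measurable
  also have "(\<integral>\<^sup>+x. ennreal (cmod (f x)) * ennreal (cmod (g x)) \<partial>M) = ennreal I"
    unfolding I_def by (subst nn_integral_eq_integral[symmetric]) (auto simp: int ennreal_mult)
  also have "(\<integral>\<^sup>+x. (ennreal (cmod (f x)))\<^sup>2 \<partial>M) = ennreal ((fun_norm M f)\<^sup>2)"
    unfolding fun_norm_square using f
    by (subst nn_integral_eq_integral[symmetric]) (auto simp: square_integrable_def ennreal_power)
  also have "(\<integral>\<^sup>+x. (ennreal (cmod (g x)))\<^sup>2 \<partial>M) = ennreal ((fun_norm M g)\<^sup>2)"
    unfolding fun_norm_square using g
    by (subst nn_integral_eq_integral[symmetric]) (auto simp: square_integrable_def ennreal_power)
  finally have "ennreal (I\<^sup>2) \<le> ennreal ((fun_norm M f * fun_norm M g)\<^sup>2)"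
    using I0 by (simp add: ennreal_power power_mult_distrib ennreal_mult)
  then have "I\<^sup>2 \<le> (fun_norm M f * fun_norm M g)\<^sup>2" by (simp add: ennreal_le_iff)
  then show ?thesis unfolding I_def[symmetric] by (rule power2_le_imp_le) simp
qed

lemma cmod_fun_inner_le:
  assumes f: "f \<in> square_integrable M" and g: "g \<in> square_integrable M"
  shows "cmod (fun_inner M f g) \<le> fun_norm M f * fun_norm M g"
proof -
  have "cmod (fun_inner M f g) \<le> (LINT x|M. cmod (f x * cnj (g x)))"
    unfolding fun_inner_def by (rule integral_norm_bound)
  also have "\<dots> \<le> fun_norm M f * fun_norm M g"
    using integral_cmod_mult_le[OF f g] by (simp add: norm_mult)
  finally show ?thesis .
qed

lemma fun_norm_minus_commute: "fun_norm M (\<lambda>x. f x - g x) = fun_norm M (\<lambda>x. g x - f x)"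
  by (simp add: fun_norm_def norm_minus_commute)

lemma fun_norm_diff_triangle:
  assumes f: "f \<in> square_integrable M" and g: "g \<in> square_integrable M"
    and h: "h \<in> square_integrable M"
  shows "fun_norm M (\<lambda>x. f x - h x) \<le> fun_norm M (\<lambda>x. f x - g x) + fun_norm M (\<lambda>x. g x - h x)"
proof (rule power2_le_imp_le)
  let ?u = "\<lambda>x. f x - g x" and ?v = "\<lambda>x. h x - g x"
  have uv: "?u \<in> square_integrable M" "?v \<in> square_integrable M"
    using f g h by (auto intro: square_integrable_diff)
  have "(fun_norm M (\<lambda>x. f x - h x))\<^sup>2 = (fun_norm M (\<lambda>x. ?u x - ?v x))\<^sup>2" by simp
  also have "\<dots> = (fun_norm M ?u)\<^sup>2 - 2 * Re (fun_inner M ?u ?v) + (fun_norm M ?v)\<^sup>2"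
    by (rule fun_norm_square_diff[OF uv])
  also have "\<dots> \<le> (fun_norm M ?u)\<^sup>2 + 2 * (fun_norm M ?u * fun_norm M ?v) + (fun_norm M ?v)\<^sup>2"
    using cmod_fun_inner_le[OF uv] abs_Re_le_cmod[of "fun_inner M ?u ?v"] by linarith
  also have "\<dots> = (fun_norm M ?u + fun_norm M ?v)\<^sup>2" by (simp add: power2_sum)
  finally show "(fun_norm M (\<lambda>x. f x - h x))\<^sup>2 \<le> (fun_norm M ?u + fun_norm M (\<lambda>x. g x - h x))\<^sup>2"
    by (simp only: fun_norm_minus_commute[of M h g])
qed simp

text \<open>
  Completeness of \<open>L\<^sup>2\<close> in the form of fast convergent sequences. On a finite measure the \<open>L\<^sup>2\<close> bound on
  the steps bounds their \<open>L\<^sup>1\<close> norms, so the telescoping series converges absolutely almost everywhere;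
  Fatou's lemma then estimates the distance to the pointwise limit.
\<close>

lemma L2_complete:
  assumes fin: "finite_measure M" and s: "\<And>k. s k \<in> square_integrable M"
    and step: "\<And>k. fun_norm M (\<lambda>x. s (Suc k) x - s k x) \<le> (1/2) ^ k"
  shows "\<exists>f\<in>square_integrable M. (\<lambda>k. fun_norm M (\<lambda>x. f x - s k x)) \<longlonglongrightarrow> 0"
proof -
  interpret finite_measure M by fact
  have [measurable]: "\<And>k. s k \<in> borel_measurable M" using s by auto
  define d where "d k x = cmod (s (Suc k) x - s k x)" for k x
  have [measurable]: "\<And>k. d k \<in> borel_measurable M" unfolding d_def by measurable
  have ds: "(\<lambda>x. s (Suc k) x - s k x) \<in> square_integrable M" for k
    using s by (intro square_integrable_diff)
  have one: "(\<lambda>x. 1) \<in> square_integrable M" by (simp add: square_integrable_def)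
  define C where "C = fun_norm M (\<lambda>x. 1)"
  have C0: "C \<ge> 0" by (simp add: C_def)
  have dint: "(\<integral>\<^sup>+x. ennreal (d k x) \<partial>M) \<le> ennreal (C * (1/2) ^ k)" for k
  proof -
    have "integrable M (d k)"
      using integrable_norm[OF integrable_mult_cnj[OF ds[of k] one]] by (simp add: d_def[abs_def])
    then have "(\<integral>\<^sup>+x. ennreal (d k x) \<partial>M) = ennreal (LINT x|M. d k x)"
      by (rule nn_integral_eq_integral) (simp add: d_def)
    also have "(LINT x|M. d k x) \<le> fun_norm M (\<lambda>x. s (Suc k) x - s k x) * C"
      using integral_cmod_mult_le[OF ds[of k] one] by (simp add: d_def C_def)
    also have "\<dots> \<le> (1/2) ^ k * C" by (intro mult_right_mono step C0)
    finally show ?thesis by (simp add: mult.commute ennreal_leI)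
  qed
  have "(\<integral>\<^sup>+x. (\<Sum>k. ennreal (d k x)) \<partial>M) = (\<Sum>k. \<integral>\<^sup>+x. ennreal (d k x) \<partial>M)"
    by (rule nn_integral_suminf) measurable
  also have "\<dots> \<le> (\<Sum>k. ennreal (C * (1/2) ^ k))"
    by (intro suminf_le dint) auto
  also have "\<dots> = ennreal (\<Sum>k. C * (1/2) ^ k)"
    by (intro suminf_ennreal2) (auto simp: C0 intro!: summable_mult summable_geometric)
  finally have "(\<integral>\<^sup>+x. (\<Sum>k. ennreal (d k x)) \<partial>M) \<noteq> \<infinity>"
    by (auto simp: top_unique)
  then have "AE x in M. (\<Sum>k. ennreal (d k x)) \<noteq> \<infinity>"
    by (intro nn_integral_noteq_infinite) measurable
  then have conv: "AE x in M. convergent (\<lambda>k. s k x)"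
  proof eventually_elim
    case (elim x)
    have "summable (\<lambda>k. d k x)"
      by (rule summable_suminf_not_top) (use elim in \<open>auto simp: d_def\<close>)
    then have "summable (\<lambda>k. s (Suc k) x - s k x)"
      unfolding d_def by (rule summable_norm_cancel)
    then have "convergent (\<lambda>n. \<Sum>k<n. s (Suc k) x - s k x)"
      by (simp add: summable_iff_convergent)
    then have "convergent (\<lambda>n. s n x - s 0 x)"
      by (simp only: sum_lessThan_telescope[of "\<lambda>k. s k x"])
    then have "convergent (\<lambda>n. (s n x - s 0 x) + s 0 x)"
      by (intro convergent_add convergent_const)
    then show ?case by simp
  qed
  define f where "f x = lim (\<lambda>k. s k x)" for x
  have [measurable]: "f \<in> borel_measurable M" unfolding f_def by measurable
  have tail: "fun_norm M (\<lambda>x. s (k + m) x - s k x) \<le> 2 * (1/2) ^ k" for k m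
  proof -
    have "fun_norm M (\<lambda>x. s (k + m) x - s k x) \<le> 2 * (1/2) ^ k - 2 * (1/2) ^ (k + m)"
    proof (induction m)
      case 0 then show ?case by (simp add: fun_norm_def)
    next
      case (Suc m)
      then show ?case
        using fun_norm_diff_triangle[OF s[of "Suc (k + m)"] s[of "k + m"] s[of k]] step[of "k + m"] by simp
    qed
    also have "\<dots> \<le> 2 * (1/2) ^ k" by simp
    finally show ?thesis .
  qed
  have bound: "(\<integral>\<^sup>+x. ennreal ((cmod (f x - s k x))\<^sup>2) \<partial>M) \<le> ennreal ((2 * (1/2) ^ k)\<^sup>2)" for k
  proof -
    have "(\<integral>\<^sup>+x. ennreal ((cmod (f x - s k x))\<^sup>2) \<partial>M)
        = (\<integral>\<^sup>+x. liminf (\<lambda>m. ennreal ((cmod (s (k + m) x - s k x))\<^sup>2)) \<partial>M)"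
    proof (rule nn_integral_cong_AE)
      show "AE x in M. ennreal ((cmod (f x - s k x))\<^sup>2)
          = liminf (\<lambda>m. ennreal ((cmod (s (k + m) x - s k x))\<^sup>2))"
        using conv
      proof eventually_elim
        case (elim x)
        then have "(\<lambda>m. s m x) \<longlonglongrightarrow> f x" by (simp add: f_def convergent_LIMSEQ_iff)
        then have "(\<lambda>m. s (k + m) x) \<longlonglongrightarrow> f x"
          using LIMSEQ_ignore_initial_segment[of "\<lambda>m. s m x" "f x" k] by (simp add: add.commute)
        then have "(\<lambda>m. ennreal ((cmod (s (k + m) x - s k x))\<^sup>2)) \<longlonglongrightarrow> ennreal ((cmod (f x - s k x))\<^sup>2)"
          by (intro tendsto_intros)
        then show ?case by (rule lim_imp_Liminf[OF trivial_limit_sequentially, symmetric])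
      qed
    qed
    also have "\<dots> \<le> liminf (\<lambda>m. \<integral>\<^sup>+x. ennreal ((cmod (s (k + m) x - s k x))\<^sup>2) \<partial>M)"
      by (rule nn_integral_liminf) measurable
    also have "\<dots> \<le> ennreal ((2 * (1/2) ^ k)\<^sup>2)"
    proof -
      have "(\<integral>\<^sup>+x. ennreal ((cmod (s (k + m) x - s k x))\<^sup>2) \<partial>M) \<le> ennreal ((2 * (1/2) ^ k)\<^sup>2)" for m
      proof -
        have "(\<integral>\<^sup>+x. ennreal ((cmod (s (k + m) x - s k x))\<^sup>2) \<partial>M)
            = ennreal ((fun_norm M (\<lambda>x. s (k + m) x - s k x))\<^sup>2)"
          unfolding fun_norm_square using square_integrable_diff[OF s[of "k + m"] s[of k]]
          by (intro nn_integral_eq_integral) (auto simp: square_integrable_def)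
        also have "\<dots> \<le> ennreal ((2 * (1/2) ^ k)\<^sup>2)"
          by (intro ennreal_leI power_mono tail) simp
        finally show ?thesis .
      qed
      then have "liminf (\<lambda>m. \<integral>\<^sup>+x. ennreal ((cmod (s (k + m) x - s k x))\<^sup>2) \<partial>M)
          \<le> liminf (\<lambda>m. ennreal ((2 * (1/2) ^ k)\<^sup>2))"
        by (intro Liminf_mono always_eventually allI)
      then show ?thesis by (simp add: Liminf_const)
    qed
    finally show ?thesis .
  qed
  have dsi: "(\<lambda>x. f x - s k x) \<in> square_integrable M" for k
    unfolding square_integrable_def using bound[of k]
    by (auto simp: integrable_iff_bounded intro: le_less_trans)
  have "(\<lambda>x. (f x - s 0 x) + s 0 x) \<in> square_integrable M"
    by (intro square_integrable_add dsi s)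
  then have fsi: "f \<in> square_integrable M" by simp
  have bd: "fun_norm M (\<lambda>x. f x - s k x) \<le> 2 * (1/2) ^ k" for k
  proof -
    have "ennreal ((fun_norm M (\<lambda>x. f x - s k x))\<^sup>2) = (\<integral>\<^sup>+x. ennreal ((cmod (f x - s k x))\<^sup>2) \<partial>M)"
      unfolding fun_norm_square using dsi[of k]
      by (intro nn_integral_eq_integral[symmetric]) (auto simp: square_integrable_def)
    also note bound[of k]
    finally have "(fun_norm M (\<lambda>x. f x - s k x))\<^sup>2 \<le> (2 * (1/2) ^ k)\<^sup>2"
      by (simp add: ennreal_le_iff)
    then show ?thesis by (rule power2_le_imp_le) simp
  qed
  have "(\<lambda>k. 2 * (1/2) ^ k :: real) \<longlonglongrightarrow> 0"
    by (intro tendsto_mult_right_zero LIMSEQ_power_zero) simp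
  from tendsto_sandwich[OF _ _ tendsto_const this]
  have "(\<lambda>k. fun_norm M (\<lambda>x. f x - s k x)) \<longlonglongrightarrow> 0"
    by this
       (intro always_eventually allI fun_norm_nonneg bd)+
  then show ?thesis
    by - (rule bexI[where x = f], assumption, rule fsi)
qed

lemma L2E:
  assumes "F \<in> L2 M"
  obtains f where "f \<in> square_integrable M" "F = ae_class M f"
  using assms by (auto simp: L2_def)

lemma l2_inner_eq_fun_inner:
  "f \<in> square_integrable M \<Longrightarrow> g \<in> square_integrable M \<Longrightarrow>
     l2_inner M (ae_class M f) (ae_class M g) = fun_inner M f g"
  by (simp add: l2_inner_ae_class fun_inner_def)

lemma l2_dist_eq_fun_norm:
  "f \<in> square_integrable M \<Longrightarrow> g \<in> square_integrable M \<Longrightarrow>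
     l2_dist M (ae_class M f) (ae_class M g) = fun_norm M (\<lambda>x. f x - g x)"
  by (simp add: l2_dist_ae_class fun_norm_def)

lemma ae_class_in_L2: "f \<in> square_integrable M \<Longrightarrow> ae_class M f \<in> L2 M"
  by (simp add: L2_def)

lemma l2_dist_triangle:
  assumes "F \<in> L2 M" "G \<in> L2 M" "P \<in> L2 M"
  shows "l2_dist M F P \<le> l2_dist M F G + l2_dist M G P"
proof -
  obtain f g p where "f \<in> square_integrable M" "F = ae_class M f"
    "g \<in> square_integrable M" "G = ae_class M g" "p \<in> square_integrable M" "P = ae_class M p"
    using assms by (metis L2E)
  then show ?thesis using fun_norm_diff_triangle[of f M g p] by (simp add: l2_dist_eq_fun_norm)
qed

lemma l2_dist_self: "F \<in> L2 M \<Longrightarrow> l2_dist M F F = 0"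
  by (simp add: l2_dist_def)

lemma l2_closure_subset_L2: "l2_closure M S \<subseteq> L2 M"
  by (auto simp: l2_closure_def)

lemma subset_l2_closure: "S \<subseteq> L2 M \<Longrightarrow> S \<subseteq> l2_closure M S"
  by (force simp: l2_closure_def l2_dist_self)

lemma l2_closure_mono: "S \<subseteq> S' \<Longrightarrow> l2_closure M S \<subseteq> l2_closure M S'"
  by (force simp: l2_closure_def)

lemma l2_closure_idem:
  assumes S: "S \<subseteq> L2 M" shows "l2_closure M (l2_closure M S) = l2_closure M S"
proof
  show "l2_closure M (l2_closure M S) \<subseteq> l2_closure M S"
  proof
    fix F assume F: "F \<in> l2_closure M (l2_closure M S)"
    show "F \<in> l2_closure M S" unfolding l2_closure_def
    proof (intro CollectI conjI allI impI)
      show FL: "F \<in> L2 M" using F l2_closure_subset_L2 by blast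
      fix e :: real assume "e > 0"
      then have e2: "e / 2 > 0" by simp
      then obtain G where G: "G \<in> l2_closure M S" "l2_dist M F G < e / 2"
        using F unfolding l2_closure_def[of M "l2_closure M S"] by blast
      then obtain P where P: "P \<in> S" "l2_dist M G P < e / 2"
        using e2 unfolding l2_closure_def by blast
      have "l2_dist M F P < e"
        using l2_dist_triangle[of F M G P] FL G P S l2_closure_subset_L2[of M S] by fastforce
      then show "\<exists>P\<in>S. l2_dist M F P < e" using P by blast
    qed
  qed
qed (intro subset_l2_closure l2_closure_subset_L2)

section \<open>Unconditional sums\<close>

lemma has_sum_approxI:
  fixes f :: "'i \<Rightarrow> 'b::real_normed_vector"
  assumes "\<And>e. e > 0 \<Longrightarrow> \<exists>X. finite X \<and> (\<forall>Y. finite Y \<longrightarrow> X \<subseteq> Y \<longrightarrow> norm (sum f Y - s) < e)"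
  shows "(f has_sum s) UNIV"
  unfolding has_sum_def tendsto_iff eventually_finite_subsets_at_top dist_norm
proof (intro allI impI)
  fix e :: real assume "e > 0"
  from assms[OF this] obtain X
    where "finite X \<and> (\<forall>Y. finite Y \<longrightarrow> X \<subseteq> Y \<longrightarrow> norm (sum f Y - s) < e)"
    by (rule exE)
  then show "\<exists>X. finite X \<and> X \<subseteq> UNIV \<and> (\<forall>Y. finite Y \<and> X \<subseteq> Y \<and> Y \<subseteq> UNIV \<longrightarrow> norm (sum f Y - s) < e)"
    by (intro exI[of _ X]) simp
qed

text \<open>
  Finitely many indices carry all of the sum except for \<open>e / 2\<close>, and on those the terms tend to \<open>0\<close> as
  \<open>N\<close> grows; on the remaining indices it is enough that \<open>b j ^ N\<close> does not exceed \<open>1\<close>.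
\<close>

lemma damped_has_sum_less:
  fixes g b :: "'i \<Rightarrow> real"
  assumes g: "(g has_sum s) UNIV" "\<And>j. g j \<ge> 0" and b: "\<And>j. 0 \<le> b j" "\<And>j. g j \<noteq> 0 \<Longrightarrow> b j < 1"
    and b1: "\<And>j. b j \<le> 1" and e: "e > 0"
  shows "\<exists>N. \<forall>t. ((\<lambda>j. b j ^ N * g j) has_sum t) UNIV \<longrightarrow> t < e"
proof -
  have "eventually (\<lambda>X. dist (sum g X) s < e / 2) (finite_subsets_at_top UNIV)"
    using g(1) e unfolding has_sum_def by (intro tendstoD) auto
  then obtain X where X: "finite X" "dist (sum g X) s < e / 2"
    unfolding eventually_finite_subsets_at_top by auto
  have "(\<lambda>N. \<Sum>j\<in>X. b j ^ N * g j) \<longlonglongrightarrow> (\<Sum>j\<in>X. 0)"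
  proof (rule tendsto_sum)
    fix j
    show "(\<lambda>N. b j ^ N * g j) \<longlonglongrightarrow> 0"
    proof (cases "g j = 0")
      case False
      then show ?thesis using b by (intro tendsto_mult_left_zero LIMSEQ_power_zero) auto
    qed simp
  qed
  then have "eventually (\<lambda>N. (\<Sum>j\<in>X. b j ^ N * g j) < e / 2) sequentially"
    using e by (intro order_tendstoD) auto
  then obtain N where N: "(\<Sum>j\<in>X. b j ^ N * g j) < e / 2" by (auto simp: eventually_sequentially)
  have "t < e" if t: "((\<lambda>j. b j ^ N * g j) has_sum t) UNIV" for t
  proof -
    \<comment> \<open>The correction that turns g into its damped version on X and leaves it alone elsewhere.\<close>
    let ?d = "\<lambda>j. if j \<in> X then b j ^ N * g j - g j else 0"
    have "(?d has_sum (\<Sum>j\<in>X. b j ^ N * g j - g j)) UNIV"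
      using X by (intro has_sum_finite_neutralI[of X]) auto
    from has_sum_add[OF g(1) this]
    have u: "((\<lambda>j. g j + ?d j) has_sum (s + (\<Sum>j\<in>X. b j ^ N * g j - g j))) UNIV" .
    have "b j ^ N * g j \<le> g j + ?d j" for j
      using b b1 g(2) by (auto intro!: mult_left_le_one_le power_le_one)
    from has_sum_mono[OF t u this] have "t \<le> s + (\<Sum>j\<in>X. b j ^ N * g j - g j)" .
    also have "\<dots> = s - sum g X + (\<Sum>j\<in>X. b j ^ N * g j)" by (simp add: sum_subtractf)
    also have "\<dots> < e" using N X(2) unfolding dist_real_def by linarith
    finally show ?thesis .
  qed
  then show ?thesis by blast
qed

section \<open>The annulus\<close>

locale annulus_radius =
  fixes r :: real
  assumes r_pos: "0 < r" and r_less_1: "r < 1"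
begin

abbreviation M :: "complex measure" where "M \<equiv> annulus_measure r"
abbreviation K :: "complex set" where "K \<equiv> {z. r \<le> cmod z \<and> cmod z \<le> 1}"

definition zpow :: "int \<Rightarrow> complex \<Rightarrow> complex" where "zpow j z = z powi j"

definition \<omega> :: "int \<Rightarrow> real" where "\<omega> j = (fun_norm M (zpow j))\<^sup>2"

lemma open_annulus: "open (annulus r)"
proof -
  have "annulus r = {z. r < cmod z} \<inter> {z. cmod z < 1}" by (auto simp: annulus_def)
  then show ?thesis
    by (auto intro!: open_Int open_Collect_less continuous_intros)
qed

lemma annulus_subset: "annulus r \<subseteq> K" by (auto simp: annulus_def)

lemma K_nonzero: "z \<in> K \<Longrightarrow> z \<noteq> 0"
  by (rule notI) (use r_pos in auto)

lemma compact_K: "compact K"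
proof -
  have "K = {z. r \<le> cmod z} \<inter> cball 0 1" by auto
  moreover have "closed {z::complex. r \<le> cmod z}"
    by (intro closed_Collect_le continuous_intros)
  ultimately show ?thesis by (simp add: closed_Int_compact)
qed

lemma closure_annulus: "closure (annulus r) = K"
proof
  show "closure (annulus r) \<subseteq> K"
    using compact_K annulus_subset by (intro closure_minimal compact_imp_closed)
  show "K \<subseteq> closure (annulus r)"
  proof
    fix z assume z: "z \<in> K"
    \<comment> \<open>A boundary point is approached along its radius, towards the circle of radius c.\<close>
    define c where "c = (r + 1) / 2"
    define s where "s t = (1 - t) * cmod z + t * c" for t :: real
    have c: "r < c" "c < 1" using r_less_1 by (auto simp: c_def)
    have z0: "cmod z > 0" using K_nonzero[OF z] by simp
    have "((\<lambda>t. of_real (s t / cmod z) * z) \<longlongrightarrow> of_real (s 0 / cmod z) * z) (at_right 0)"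
      unfolding s_def using z0 by (intro tendsto_intros) auto
    moreover have "s 0 = cmod z" by (simp add: s_def)
    ultimately have lim: "((\<lambda>t. of_real (s t / cmod z) * z) \<longlongrightarrow> z) (at_right 0)"
      using z0 by auto
    have "eventually (\<lambda>t. t \<in> {0<..<1}) (at_right (0::real))"
      by (intro eventually_at_right_real) simp
    then have "eventually (\<lambda>t. of_real (s t / cmod z) * z \<in> annulus r) (at_right 0)"
    proof eventually_elim
      case (elim t)
      have "s t - r = (1 - t) * (cmod z - r) + t * (c - r)" by (simp add: s_def algebra_simps)
      also have "\<dots> > 0" using elim z c by (intro add_nonneg_pos mult_nonneg_nonneg mult_pos_pos) auto
      finally have 1: "r < s t" by simp
      have "1 - s t = (1 - t) * (1 - cmod z) + t * (1 - c)" by (simp add: s_def algebra_simps)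
      also have "\<dots> > 0" using elim z c by (intro add_nonneg_pos mult_nonneg_nonneg mult_pos_pos) auto
      finally have 2: "s t < 1" by simp
      have "cmod (of_real (s t / cmod z) * z) = s t"
        using 1 r_pos z0 by (simp add: norm_mult norm_divide)
      then show ?case using 1 2 by (simp add: annulus_def)
    qed
    then have "eventually (\<lambda>t. of_real (s t / cmod z) * z \<in> closure (annulus r)) (at_right 0)"
      by (rule eventually_mono) (use closure_subset in auto)
    from Lim_in_closed_set[OF closed_closure this _ lim] show "z \<in> closure (annulus r)" by simp
  qed
qed

lemma finite_M: "finite_measure M"
  by (intro finite_measure_lebesgue_on lmeasurable_open open_annulus)
     (auto intro: bounded_subset[OF compact_imp_bounded[OF compact_K] annulus_subset])

lemma continuous_imp_measurable:
  fixes f :: "complex \<Rightarrow> 'b::euclidean_space"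
  shows "continuous_on (annulus r) f \<Longrightarrow> f \<in> borel_measurable M"
  by (intro continuous_imp_measurable_on_sets_lebesgue) (auto simp: open_annulus)

lemma bounded_continuous_integrable:
  fixes f :: "complex \<Rightarrow> 'b::euclidean_space"
  assumes "continuous_on (annulus r) f" "\<And>z. z \<in> annulus r \<Longrightarrow> norm (f z) \<le> B"
  shows "integrable M f"
  using assms continuous_imp_measurable[OF assms(1)]
  by (intro finite_measure.integrable_const_bound[OF finite_M, of _ B]) (auto intro!: AE_I2)

lemma continuous_on_K_bounded:
  fixes f :: "complex \<Rightarrow> 'b::euclidean_space"
  assumes f: "continuous_on K f"
  obtains B where "B > 0" "\<And>z. z \<in> K \<Longrightarrow> norm (f z) \<le> B"
  using compact_imp_bounded[OF compact_continuous_image[OF f compact_K]]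
  unfolding bounded_pos by auto

lemma continuous_on_K_integrable:
  fixes f :: "complex \<Rightarrow> 'b::euclidean_space"
  assumes f: "continuous_on K f"
  shows "integrable M f"
proof -
  obtain B where "\<And>z. z \<in> K \<Longrightarrow> norm (f z) \<le> B" using continuous_on_K_bounded[OF f] by blast
  then show ?thesis
    using annulus_subset continuous_on_subset[OF f annulus_subset]
    by (intro bounded_continuous_integrable[of f B]) auto
qed

lemma continuous_on_K_square_integrable:
  assumes f: "continuous_on K f"
  shows "f \<in> square_integrable M"
proof -
  have "continuous_on K (\<lambda>z. (cmod (f z))\<^sup>2)" by (intro continuous_intros f)
  then show ?thesis
    unfolding square_integrable_def
    using continuous_on_K_integrable continuous_imp_measurable[OF continuous_on_subset[OF f annulus_subset]]
    by auto
qed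

lemma fun_norm_le_sup:
  assumes f: "f \<in> square_integrable M" and B: "\<And>z. z \<in> K \<Longrightarrow> cmod (f z) \<le> B" and "B \<ge> 0"
  shows "fun_norm M f \<le> B * fun_norm M (\<lambda>z. 1)"
proof (rule power2_le_imp_le)
  have "(fun_norm M f)\<^sup>2 \<le> (LINT z|M. B\<^sup>2 * (cmod 1)\<^sup>2)"
    unfolding fun_norm_square
  proof (rule integral_mono)
    show "integrable M (\<lambda>x. (cmod (f x))\<^sup>2)" using f by (simp add: square_integrable_def)
    show "integrable M (\<lambda>x. B\<^sup>2 * (cmod 1)\<^sup>2)"
      by (intro continuous_on_K_integrable continuous_intros)
    fix x assume "x \<in> space M"
    then show "(cmod (f x))\<^sup>2 \<le> B\<^sup>2 * (cmod 1)\<^sup>2"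
      using B annulus_subset by (auto intro!: power_mono)
  qed
  also have "\<dots> = (B * fun_norm M (\<lambda>z. 1))\<^sup>2"
    unfolding power_mult_distrib fun_norm_square by (rule integral_mult_right_zero)
  finally show "(fun_norm M f)\<^sup>2 \<le> (B * fun_norm M (\<lambda>z. 1))\<^sup>2" .
qed (use \<open>B \<ge> 0\<close> in simp)

lemma continuous_on_zpow: "continuous_on K (zpow j)"
  unfolding zpow_def using K_nonzero by (intro continuous_intros) auto

lemma zpow_square_integrable [simp]: "zpow j \<in> square_integrable M"
  by (intro continuous_on_K_square_integrable continuous_on_zpow)

lemma zpow_add: "z \<in> K \<Longrightarrow> zpow (i + j) z = zpow i z * zpow j z"
  unfolding zpow_def by (intro power_int_add) (use K_nonzero in auto)

section \<open>Orthogonality of the monomials and their norms\<close>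

text \<open>
  The annulus and the measure are invariant under rotation. The integrand is only continuous on the
  annulus, so the change of variables is made for its extension by zero, which is a Borel function.
\<close>

lemma integral_rotate:
  fixes f :: "complex \<Rightarrow> complex"
  assumes f: "continuous_on (annulus r) f" and w: "cmod w = 1"
  shows "(LINT z|M. f (w * z)) = (LINT z|M. f z)"
proof -
  let ?g = "\<lambda>z. indicator (annulus r) z *\<^sub>R f z"
  have ann: "annulus r \<in> sets lebesgue" using open_annulus by auto
  have inv: "w * z \<in> annulus r \<longleftrightarrow> z \<in> annulus r" for z
    using w by (simp add: annulus_def norm_mult)
  have [measurable]: "?g \<in> borel_measurable borel"
    by (intro borel_measurable_continuous_on_indicator f) (use open_annulus in auto)
  have "(LINT z|M. f z) = (LINT z|lebesgue. ?g z)"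
    using ann by (intro integral_restrict_space) auto
  also have "\<dots> = (LINT z|lborel. ?g z)"
    by (intro integral_completion) auto
  also have "\<dots> = (LINT z|distr lborel borel (\<lambda>z. w * z). ?g z)"
    by (simp only: lborel_distr_rotation[OF w])
  also have "\<dots> = (LINT z|lborel. ?g (w * z))"
    by (intro integral_distr) auto
  also have "\<dots> = (LINT z|lebesgue. ?g (w * z))"
    by (intro integral_completion[symmetric]) auto
  also have "\<dots> = (LINT z|lebesgue. indicator (annulus r) z *\<^sub>R f (w * z))"
    by (intro Bochner_Integration.integral_cong refl) (simp add: indicator_def inv)
  also have "\<dots> = (LINT z|M. f (w * z))"
    using ann by (intro integral_restrict_space[symmetric]) auto
  finally show ?thesis by simp
qed

text \<open>
  Rotation by \<open>w\<close> with \<open>w powi (i - j) = -1\<close> turns the integral into its negative.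
\<close>

lemma zpow_orthogonal:
  assumes "i \<noteq> j" shows "fun_inner M (zpow i) (zpow j) = 0"
proof -
  let ?f = "\<lambda>z. zpow i z * cnj (zpow j z)"
  define w where "w = cis (pi / of_int (i - j))"
  have w: "cmod w = 1" "w \<noteq> 0" by (auto simp: w_def)
  have "cnj w = inverse w" by (simp add: w_def cis_cnj)
  then have "zpow i w * cnj (zpow j w) = w powi i * inverse w powi j"
    by (simp add: zpow_def)
  also have "\<dots> = w powi (i - j)"
    using w by (simp add: power_int_diff power_int_inverse divide_inverse)
  also have "\<dots> = -1"
    using assms by (simp add: w_def cis_power_int)
  finally have ww: "zpow i w * cnj (zpow j w) = -1" .
  have "?f (w * z) = (zpow i w * cnj (zpow j w)) * ?f z" for z
    by (simp add: zpow_def power_int_mult_distrib mult_ac)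
  then have neg: "?f (w * z) = - ?f z" for z unfolding ww by simp
  have "continuous_on (annulus r) ?f"
    using continuous_on_subset[OF continuous_on_zpow annulus_subset] by (intro continuous_intros) auto
  from integral_rotate[OF this w(1)] have "(LINT z|M. ?f z) = (LINT z|M. ?f (w * z))" by simp
  also have "\<dots> = (LINT z|M. - ?f z)" by (simp only: neg)
  also have "\<dots> = - (LINT z|M. ?f z)" by (rule integral_minus)
  finally show ?thesis by (simp add: fun_inner_def)
qed

lemma fun_inner_zpow: "fun_inner M (zpow i) (zpow j) = (if i = j then of_real (\<omega> j) else 0)"
  by (simp add: zpow_orthogonal fun_inner_self \<omega>_def)

lemma integral_pos:
  fixes g :: "complex \<Rightarrow> real"
  assumes g: "continuous_on K g" and nn: "\<And>z. z \<in> annulus r \<Longrightarrow> g z \<ge> 0"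
    and z: "z \<in> annulus r" "g z > 0"
  shows "(LINT z|M. g z) > 0"
proof (rule ccontr)
  assume "\<not> ?thesis"
  moreover have "(LINT z|M. g z) \<ge> 0" using nn by (intro integral_nonneg_AE AE_I2) auto
  ultimately have "(LINT z|M. g z) = 0" by simp
  then have "AE z in M. g z = 0"
    using nn by (subst (asm) integral_nonneg_eq_0_iff_AE) (auto intro: continuous_on_K_integrable[OF g])
  then have "AE z\<in>annulus r in lebesgue. z \<in> {z \<in> K. g z = 0}"
    using open_annulus annulus_subset by (subst (asm) AE_restrict_space_iff) (auto elim!: AE_mp)
  moreover have "closed {z \<in> K. g z = 0}"
    by (intro continuous_closed_preimage_constant g compact_imp_closed[OF compact_K])
  ultimately have "z \<in> {z \<in> K. g z = 0}"
    using mem_closed_if_AE_lebesgue_open[OF open_annulus] z by blast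
  then show False using z by simp
qed

lemma \<omega>_integral: "\<omega> j = (LINT z|M. (cmod z)\<^sup>2 powi j)"
  unfolding \<omega>_def fun_norm_square zpow_def
  by (simp only: norm_power_int power2_eq_square power_int_mult_distrib)

lemma continuous_on_powi: "continuous_on K (\<lambda>z. (cmod z)\<^sup>2 powi j)"
  using K_nonzero by (intro continuous_intros) auto

lemma annulus_cmod: "r < s \<Longrightarrow> s < 1 \<Longrightarrow> of_real s \<in> annulus r"
  using r_pos by (simp add: annulus_def)

lemma \<omega>_pos: "\<omega> j > 0"
  unfolding \<omega>_integral
proof (rule integral_pos[OF continuous_on_powi])
  show "of_real ((r + 1) / 2) \<in> annulus r" by (rule annulus_cmod) (use r_less_1 in auto)
  show "0 < (cmod (of_real ((r + 1) / 2)))\<^sup>2 powi j"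
    using r_pos by (intro zero_less_power_int) auto
qed (auto intro!: zero_le_power_int)

lemma \<omega>_antimono: "\<omega> (j + int n) \<le> \<omega> j"
  unfolding \<omega>_integral
proof (intro integral_mono continuous_on_K_integrable continuous_on_powi)
  fix z assume "z \<in> space M"
  then have z: "z \<in> K" using annulus_subset by auto
  then have "(cmod z)\<^sup>2 powi (j + int n) = (cmod z)\<^sup>2 powi j * ((cmod z)\<^sup>2) ^ n"
    using K_nonzero[OF z] by (simp add: power_int_add)
  also have "\<dots> \<le> (cmod z)\<^sup>2 powi j"
    using z by (intro mult_left_le zero_le_power_int power_le_one) auto
  finally show "(cmod z)\<^sup>2 powi (j + int n) \<le> (cmod z)\<^sup>2 powi j" .
qed

text \<open>
  The eigenvalue of \<open>T\<^sup>* T\<close> at the monomial \<open>z\<^sup>j\<close>, where \<open>T\<close> is multiplication by \<open>z\<^sup>n\<close>.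
\<close>

definition eigval :: "nat \<Rightarrow> int \<Rightarrow> real" where "eigval n j = \<omega> (j + int n) / \<omega> j"

lemma eigval_bounds: "0 < eigval n j" "eigval n j \<le> 1"
  using \<omega>_pos \<omega>_antimono by (auto simp: eigval_def)

text \<open>
  Chebyshev's inequality for the two increasing functions \<open>\<bar>z\<bar>\<^sup>2\<^sup>n\<close> and \<open>\<bar>z\<bar>\<^sup>2\<^sup>d\<close> and the weight \<open>\<bar>z\<bar>\<^sup>2\<^sup>i\<close>. Let \<open>x\<close> be
  the weighted mean of the first function and \<open>t\<close> its \<open>n\<close>-th root. Then \<open>\<bar>z\<bar>\<^sup>2\<^sup>n - x\<close> and \<open>\<bar>z\<bar>\<^sup>2\<^sup>d - t\<^sup>d\<close> change
  sign on the same circle \<open>\<bar>z\<bar>\<^sup>2 = t\<close>, so their product has a positive integral. As the first factor has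
  mean zero, the constant \<open>t\<^sup>d\<close> drops out of that integral.
\<close>

lemma eigval_less:
  assumes "n > 0" "d > 0" shows "eigval n i < eigval n (i + int d)"
proof -
  define x where "x = eigval n i"
  define t where "t = root n x"
  have x: "x > 0" using eigval_bounds by (simp add: x_def)
  have t: "t > 0" "t ^ n = x" using x \<open>n > 0\<close> by (auto simp: t_def real_root_pow_pos)
  define y where "y = t ^ d"
  let ?W = "\<lambda>j z. (cmod z)\<^sup>2 powi j"
  let ?g = "\<lambda>z. ?W i z * ((((cmod z)\<^sup>2) ^ n - x) * (((cmod z)\<^sup>2) ^ d - y))"
  have sgn: "(s ^ n - x) * (s ^ d - y) \<ge> 0 \<and> (s \<noteq> t \<longrightarrow> (s ^ n - x) * (s ^ d - y) > 0)"
    if "s > 0" for s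
  proof -
    consider "s = t" | "s < t" | "s > t" by linarith
    then show ?thesis
    proof cases
      case 2
      then have "s ^ n < x" "s ^ d < y"
        unfolding y_def t(2)[symmetric] using assms that by (auto intro!: power_strict_mono)
      then have "(s ^ n - x) * (s ^ d - y) > 0" by (intro mult_neg_neg) auto
      then show ?thesis by simp
    next
      case 3
      then have "s ^ n > x" "s ^ d > y"
        unfolding y_def t(2)[symmetric] using assms t by (auto intro!: power_strict_mono)
      then have "(s ^ n - x) * (s ^ d - y) > 0" by (intro mult_pos_pos) auto
      then show ?thesis by simp
    qed (use t y_def in simp)
  qed
  \<comment> \<open>A radius at which the product does not vanish; at most one radius is excluded.\<close>
  obtain s where s: "r < s" "s < 1" "s\<^sup>2 \<noteq> t"
  proof (cases "((r + 1) / 2)\<^sup>2 = t")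
    case True
    have "((r + 1) / 2)\<^sup>2 < ((r + 2) / 3)\<^sup>2"
      using r_pos r_less_1 by (intro power_strict_mono) auto
    then show ?thesis using that[of "(r + 2) / 3"] True r_pos r_less_1 by auto
  next
    case False then show ?thesis using that[of "(r + 1) / 2"] r_pos r_less_1 by auto
  qed
  have "(LINT z|M. ?g z) > 0"
  proof (rule integral_pos)
    show "continuous_on K ?g" by (intro continuous_intros continuous_on_powi)
    show "of_real s \<in> annulus r" using s by (intro annulus_cmod)
    have "(cmod (of_real s))\<^sup>2 > 0" "(cmod (of_real s))\<^sup>2 \<noteq> t" using s r_pos by auto
    then show "?g (of_real s) > 0"
      using sgn[of "(cmod (of_real s))\<^sup>2"] by (intro mult_pos_pos[OF zero_less_power_int]) blast+
    fix z assume "z \<in> annulus r"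
    then have "(cmod z)\<^sup>2 > 0" using annulus_subset K_nonzero by auto
    then show "?g z \<ge> 0" using sgn[of "(cmod z)\<^sup>2"]
      by (intro mult_nonneg_nonneg[OF zero_le_power_int]) auto
  qed
  also have "(LINT z|M. ?g z) = (LINT z|M. ?W (i + int n + int d) z - x * ?W (i + int d) z
      - y * (?W (i + int n) z - x * ?W i z))"
  proof (intro Bochner_Integration.integral_cong refl)
    fix z assume "z \<in> space M"
    then have "(cmod z)\<^sup>2 \<noteq> 0" using annulus_subset K_nonzero by auto
    then show "?g z = ?W (i + int n + int d) z - x * ?W (i + int d) z - y * (?W (i + int n) z - x * ?W i z)"
      by (simp add: power_int_add algebra_simps)
  qed
  also have "\<dots> = \<omega> (i + int n + int d) - x * \<omega> (i + int d) - y * (\<omega> (i + int n) - x * \<omega> i)"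
    unfolding \<omega>_integral
    by (simp add: continuous_on_K_integrable[OF continuous_on_powi])
  also have "\<omega> (i + int n) - x * \<omega> i = 0"
    using \<omega>_pos[of i] by (simp add: x_def eigval_def)
  finally have "x * \<omega> (i + int d) < \<omega> (i + int d + int n)" by (simp add: add_ac)
  then show ?thesis
    using \<omega>_pos[of "i + int d"] by (simp add: x_def[symmetric] eigval_def[of n "i + int d"] pos_less_divide_eq)
qed

lemma eigval_inj:
  assumes "n > 0" "eigval n i = eigval n j" shows "i = j"
proof (rule ccontr)
  assume "i \<noteq> j"
  then consider "j = i + int (nat (j - i))" "nat (j - i) > 0" | "i = j + int (nat (i - j))" "nat (i - j) > 0"
    by linarith
  then show False
    by cases (use assms eigval_less[of n "nat (j - i)" i] eigval_less[of n "nat (i - j)" j] in auto)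
qed

section \<open>Density of the Laurent polynomials\<close>

definition laurent_polys :: "(complex \<Rightarrow> complex) set" where
  "laurent_polys = {\<lambda>z. \<Sum>j\<in>A. c j * zpow j z |A c. finite A}"

lemma laurent_polys_sum: "finite A \<Longrightarrow> (\<lambda>z. \<Sum>j\<in>A. c j * zpow j z) \<in> laurent_polys"
  by (auto simp: laurent_polys_def)

lemma laurent_polys_monomial: "(\<lambda>z. c * zpow j z) \<in> laurent_polys"
  using laurent_polys_sum[of "{j}" "\<lambda>_. c"] by simp

lemma laurent_polys_add:
  assumes "p \<in> laurent_polys" "q \<in> laurent_polys"
  shows "(\<lambda>z. p z + q z) \<in> laurent_polys"
proof -
  obtain A c B d where fin: "finite A" "finite B"
    and p: "p = (\<lambda>z. \<Sum>j\<in>A. c j * zpow j z)" and q: "q = (\<lambda>z. \<Sum>j\<in>B. d j * zpow j z)"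
    using assms by (auto simp: laurent_polys_def)
  let ?e = "\<lambda>j. (if j \<in> A then c j else 0) + (if j \<in> B then d j else 0)"
  have "p z + q z = (\<Sum>j\<in>A \<union> B. ?e j * zpow j z)" for z
  proof -
    have "p z = (\<Sum>j\<in>A \<union> B. (if j \<in> A then c j else 0) * zpow j z)"
      unfolding p using fin by (intro sum.mono_neutral_cong_left) auto
    moreover have "q z = (\<Sum>j\<in>A \<union> B. (if j \<in> B then d j else 0) * zpow j z)"
      unfolding q using fin by (intro sum.mono_neutral_cong_left) auto
    ultimately show ?thesis by (simp only: distrib_right sum.distrib)
  qed
  then show ?thesis using laurent_polys_sum[of "A \<union> B" ?e] fin by simp
qed

lemma laurent_polys_scale:
  assumes "p \<in> laurent_polys" shows "(\<lambda>z. a * p z) \<in> laurent_polys"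
proof -
  obtain A c where "finite A" "p = (\<lambda>z. \<Sum>j\<in>A. c j * zpow j z)"
    using assms by (auto simp: laurent_polys_def)
  then show ?thesis
    using laurent_polys_sum[of A "\<lambda>j. a * c j"] by (simp add: sum_distrib_left mult.assoc)
qed

lemma laurent_polys_finite_sum:
  "finite I \<Longrightarrow> (\<And>i. i \<in> I \<Longrightarrow> p i \<in> laurent_polys) \<Longrightarrow> (\<lambda>z. \<Sum>i\<in>I. p i z) \<in> laurent_polys"
proof (induction I rule: finite_induct)
  case empty then show ?case using laurent_polys_sum[of "{}"] by simp
qed (auto intro: laurent_polys_add)

text \<open>
  Equality can be asked for on the closed annulus only: at \<open>0\<close> the product of \<open>z\<close> and \<open>z powi (-1)\<close> is \<open>0\<close>,
  not \<open>1\<close>.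
\<close>

lemma laurent_polys_mult:
  assumes "p \<in> laurent_polys" "q \<in> laurent_polys"
  shows "\<exists>s\<in>laurent_polys. \<forall>z\<in>K. s z = p z * q z"
proof -
  obtain A c B d where fin: "finite A" "finite B"
    and p: "p = (\<lambda>z. \<Sum>j\<in>A. c j * zpow j z)" and q: "q = (\<lambda>z. \<Sum>j\<in>B. d j * zpow j z)"
    using assms by (auto simp: laurent_polys_def)
  let ?s = "\<lambda>z. \<Sum>i\<in>A. \<Sum>j\<in>B. (c i * d j) * zpow (i + j) z"
  have "?s \<in> laurent_polys"
    using fin by (intro laurent_polys_finite_sum laurent_polys_monomial)
  moreover have "?s z = p z * q z" if "z \<in> K" for z
    unfolding p q sum_product by (intro sum.cong refl) (simp add: zpow_add[OF that])
  ultimately show ?thesis by (intro bexI[of _ ?s]) auto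
qed

lemma laurent_polys_continuous: "p \<in> laurent_polys \<Longrightarrow> continuous_on K p"
  unfolding laurent_polys_def by (auto intro!: continuous_intros continuous_on_zpow)

lemma laurent_polys_square_integrable: "p \<in> laurent_polys \<Longrightarrow> p \<in> square_integrable M"
  by (intro continuous_on_K_square_integrable laurent_polys_continuous)

text \<open>
  Uniform approximability on the closed annulus. These functions form an algebra that is closed under
  uniform limits, so for rational functions it is enough to treat \<open>1 / (z - a)\<close>.
\<close>

definition laurent_approx :: "(complex \<Rightarrow> complex) \<Rightarrow> bool" where
  "laurent_approx f \<longleftrightarrow> (\<forall>e>0. \<exists>p\<in>laurent_polys. \<forall>z\<in>K. cmod (f z - p z) < e)"

lemma laurent_approx_limit:
  assumes "\<And>e. e > 0 \<Longrightarrow> \<exists>g. laurent_approx g \<and> (\<forall>z\<in>K. cmod (f z - g z) < e)"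
  shows "laurent_approx f"
  unfolding laurent_approx_def
proof (intro allI impI)
  fix e :: real assume "e > 0"
  then obtain g where g: "laurent_approx g" "\<And>z. z \<in> K \<Longrightarrow> cmod (f z - g z) < e / 2"
    using assms[of "e / 2"] by auto
  then obtain p where p: "p \<in> laurent_polys" "\<And>z. z \<in> K \<Longrightarrow> cmod (g z - p z) < e / 2"
    using \<open>e > 0\<close> unfolding laurent_approx_def by (meson half_gt_zero)
  have "cmod (f z - p z) < e" if "z \<in> K" for z
    using norm_diff_triangle_less[OF g(2)[OF that] p(2)[OF that]] by simp
  then show "\<exists>p\<in>laurent_polys. \<forall>z\<in>K. cmod (f z - p z) < e" using p(1) by blast
qed

lemma laurent_approx_cong:
  assumes "laurent_approx f" "\<And>z. z \<in> K \<Longrightarrow> g z = f z" shows "laurent_approx g"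
  using assms unfolding laurent_approx_def by simp

lemma laurent_approx_poly: "p \<in> laurent_polys \<Longrightarrow> laurent_approx p"
  unfolding laurent_approx_def by (auto intro!: bexI[of _ p])

lemma laurent_approx_monomial: "laurent_approx (\<lambda>z. c * zpow j z)"
  by (intro laurent_approx_poly laurent_polys_monomial)

lemma laurent_approx_const: "laurent_approx (\<lambda>z. c)"
  using laurent_approx_monomial[of c 0] by (simp add: zpow_def)

lemma laurent_approx_ident: "laurent_approx (\<lambda>z. z)"
  using laurent_approx_monomial[of 1 1] by (simp add: zpow_def)

lemma laurent_approx_add:
  assumes "laurent_approx f" "laurent_approx g" shows "laurent_approx (\<lambda>z. f z + g z)"
  unfolding laurent_approx_def
proof (intro allI impI)
  fix e :: real assume "e > 0"
  then obtain p q where p: "p \<in> laurent_polys" "\<And>z. z \<in> K \<Longrightarrow> cmod (f z - p z) < e / 2"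
    and q: "q \<in> laurent_polys" "\<And>z. z \<in> K \<Longrightarrow> cmod (g z - q z) < e / 2"
    using assms unfolding laurent_approx_def by (meson half_gt_zero)
  have "cmod (f z + g z - (p z + q z)) < e" if "z \<in> K" for z
    using norm_diff_triangle_ineq[of "f z" "g z" "p z" "q z"] p(2)[OF that] q(2)[OF that] by linarith
  then show "\<exists>p\<in>laurent_polys. \<forall>z\<in>K. cmod (f z + g z - p z) < e"
    using laurent_polys_add[OF p(1) q(1)] by (intro bexI[of _ "\<lambda>z. p z + q z"]) auto
qed

lemma laurent_approx_bounded:
  assumes "laurent_approx f"
  obtains B where "B > 0" "\<And>z. z \<in> K \<Longrightarrow> cmod (f z) \<le> B"
proof -
  obtain p where p: "p \<in> laurent_polys" "\<And>z. z \<in> K \<Longrightarrow> cmod (f z - p z) < 1"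
    using assms unfolding laurent_approx_def by (meson zero_less_one)
  obtain B where B: "B > 0" "\<And>z. z \<in> K \<Longrightarrow> cmod (p z) \<le> B"
    using continuous_on_K_bounded[OF laurent_polys_continuous[OF p(1)]] by blast
  have "cmod (f z) \<le> B + 1" if "z \<in> K" for z
    using norm_triangle_sub[of "f z" "p z"] p(2)[OF that] B(2)[OF that] by linarith
  then show thesis using that[of "B + 1"] B(1) by simp
qed

lemma laurent_approx_mult:
  assumes f: "laurent_approx f" and g: "laurent_approx g"
  shows "laurent_approx (\<lambda>z. f z * g z)"
proof (rule laurent_approx_limit)
  fix e :: real assume e: "e > 0"
  obtain B where B: "B > 0" "\<And>z. z \<in> K \<Longrightarrow> cmod (f z) \<le> B" using laurent_approx_bounded[OF f] by blast
  have "e / (2 * B) > 0" using e B by simp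
  then obtain q where q: "q \<in> laurent_polys" "\<And>z. z \<in> K \<Longrightarrow> cmod (g z - q z) < e / (2 * B)"
    using g unfolding laurent_approx_def by meson
  obtain C where C: "C > 0" "\<And>z. z \<in> K \<Longrightarrow> cmod (q z) \<le> C"
    using continuous_on_K_bounded[OF laurent_polys_continuous[OF q(1)]] by blast
  have "e / (2 * C) > 0" using e C by simp
  then obtain p where p: "p \<in> laurent_polys" "\<And>z. z \<in> K \<Longrightarrow> cmod (f z - p z) < e / (2 * C)"
    using f unfolding laurent_approx_def by meson
  obtain s where s: "s \<in> laurent_polys" "\<And>z. z \<in> K \<Longrightarrow> s z = p z * q z"
    using laurent_polys_mult[OF p(1) q(1)] by blast
  have "cmod (f z * g z - s z) < e" if z: "z \<in> K" for z
  proof -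
    have "f z * g z - s z = f z * (g z - q z) + (f z - p z) * q z"
      by (simp add: s(2)[OF z] algebra_simps)
    then have "cmod (f z * g z - s z) \<le> cmod (f z) * cmod (g z - q z) + cmod (f z - p z) * cmod (q z)"
      by (metis norm_mult norm_triangle_ineq)
    also have "cmod (f z) * cmod (g z - q z) \<le> B * cmod (g z - q z)"
      by (intro mult_right_mono B(2) z) simp
    also have "B * cmod (g z - q z) < B * (e / (2 * B))"
      by (intro mult_strict_left_mono q(2) z B(1))
    also have "cmod (f z - p z) * cmod (q z) \<le> (e / (2 * C)) * C"
      by (intro mult_mono C(2)[OF z] less_imp_le[OF p(2)[OF z]]) (use e C(1) in auto)
    finally show ?thesis using B(1) C(1) by simp
  qed
  then show "\<exists>h. laurent_approx h \<and> (\<forall>z\<in>K. cmod (f z * g z - h z) < e)"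
    using laurent_approx_poly[OF s(1)] by (intro exI[of _ s]) auto
qed

lemma laurent_approx_power: "laurent_approx f \<Longrightarrow> laurent_approx (\<lambda>z. f z ^ k)"
  by (induction k) (auto intro: laurent_approx_const laurent_approx_mult)

lemma laurent_approx_sum_power: "laurent_approx f \<Longrightarrow> laurent_approx (\<lambda>z. \<Sum>k<N. f z ^ k)"
  by (induction N) (auto intro: laurent_approx_const laurent_approx_add laurent_approx_power)

lemma laurent_approx_geometric:
  assumes u: "laurent_approx u" and \<rho>: "\<rho> < 1" "\<And>z. z \<in> K \<Longrightarrow> cmod (u z) \<le> \<rho>"
  shows "laurent_approx (\<lambda>z. 1 / (1 - u z))"
proof (rule laurent_approx_limit)
  fix e :: real assume e: "e > 0"
  have "of_real r \<in> K" using r_pos r_less_1 by simp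
  then have \<rho>0: "\<rho> \<ge> 0" using \<rho>(2) norm_ge_zero order_trans by blast
  have "(\<lambda>N. \<rho> ^ N / (1 - \<rho>)) \<longlonglongrightarrow> 0"
    using \<rho> \<rho>0 by (intro tendsto_divide_zero LIMSEQ_power_zero) auto
  then have "eventually (\<lambda>N. \<rho> ^ N / (1 - \<rho>) < e) sequentially"
    using e by (rule order_tendstoD)
  then obtain N where N: "\<rho> ^ N / (1 - \<rho>) < e" by (auto simp: eventually_sequentially)
  have "cmod (1 / (1 - u z) - (\<Sum>k<N. u z ^ k)) < e" if z: "z \<in> K" for z
  proof -
    have u1: "u z \<noteq> 1" using \<rho>(2)[OF z] \<rho>(1) by auto
    have "1 / (1 - u z) - (\<Sum>k<N. u z ^ k) = u z ^ N / (1 - u z)"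
      using u1 by (simp add: geometric_sum field_simps)
    also have "cmod \<dots> = cmod (u z) ^ N / cmod (1 - u z)" by (simp add: norm_divide norm_power)
    also have "\<dots> \<le> \<rho> ^ N / (1 - \<rho>)"
    proof (intro frac_le power_mono \<rho>(2) z)
      have "1 \<le> cmod (1 - u z) + cmod (u z)" using norm_triangle_ineq[of "1 - u z" "u z"] by simp
      then show "1 - \<rho> \<le> cmod (1 - u z)" using \<rho>(2)[OF z] by linarith
    qed (use \<rho> \<rho>0 in auto)
    finally show ?thesis using N by simp
  qed
  then show "\<exists>g. laurent_approx g \<and> (\<forall>z\<in>K. cmod (1 / (1 - u z) - g z) < e)"
    using laurent_approx_sum_power[OF u, of N] by blast
qed

text \<open>
  Geometric series: in \<open>z / a\<close> if the pole lies outside of the unit disc, in \<open>a / z\<close> if it lies in the hole.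
\<close>

lemma laurent_approx_inverse_linear:
  assumes "a \<notin> K" shows "laurent_approx (\<lambda>z. 1 / (z - a))"
proof (cases "cmod a > 1")
  case True
  have a: "a \<noteq> 0" using True by auto
  have "laurent_approx (\<lambda>z. 1 / (1 - (1 / a) * z))"
  proof (rule laurent_approx_geometric)
    show "laurent_approx (\<lambda>z. (1 / a) * z)"
      by (intro laurent_approx_mult laurent_approx_const laurent_approx_ident)
    show "1 / cmod a < 1" by (subst divide_less_eq_1_pos) (use True in linarith)+
    show "cmod ((1 / a) * z) \<le> 1 / cmod a" if "z \<in> K" for z
      using that a by (simp add: norm_divide divide_right_mono)
  qed
  from laurent_approx_mult[OF laurent_approx_const[of "- 1 / a"] this]
  show ?thesis
  proof (rule laurent_approx_cong)
    fix z assume "z \<in> K"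
    then have "z \<noteq> a" using assms by blast
    then show "1 / (z - a) = - 1 / a * (1 / (1 - 1 / a * z))" using a by (simp add: field_simps)
  qed
next
  case False
  then have a: "cmod a < r" using assms by auto
  have "laurent_approx (\<lambda>z. 1 / (1 - a * zpow (-1) z))"
  proof (rule laurent_approx_geometric)
    show "laurent_approx (\<lambda>z. a * zpow (-1) z)" by (rule laurent_approx_monomial)
    show "cmod a / r < 1" using a r_pos by simp
    show "cmod (a * zpow (-1) z) \<le> cmod a / r" if "z \<in> K" for z
      using that r_pos by (simp add: zpow_def power_int_minus norm_mult norm_inverse divide_inverse)
        (intro mult_left_mono le_imp_inverse_le, auto)
  qed
  from laurent_approx_mult[OF laurent_approx_monomial[of 1 "-1"] this]
  show ?thesis
  proof (rule laurent_approx_cong)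
    fix z assume z: "z \<in> K"
    then have "z \<noteq> a" "z \<noteq> 0" using assms K_nonzero[OF z] by auto
    then show "1 / (z - a) = 1 * zpow (- 1) z * (1 / (1 - a * zpow (- 1) z))"
      by (simp add: zpow_def power_int_minus field_simps)
  qed
qed

lemma laurent_approx_polynomial: "laurent_approx (poly p)"
proof (induction p)
  case 0 then show ?case using laurent_approx_const[of 0] by (simp add: fun_eq_iff)
next
  case (pCons a p)
  have "laurent_approx (\<lambda>z. a + z * poly p z)"
    by (intro laurent_approx_add laurent_approx_mult laurent_approx_const laurent_approx_ident pCons.IH)
  then show ?case by (rule laurent_approx_cong) simp
qed

lemma laurent_approx_inverse_polynomial:
  assumes "\<forall>z\<in>K. poly q z \<noteq> 0" shows "laurent_approx (\<lambda>z. 1 / poly q z)"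
  using assms
proof (induction "degree q" arbitrary: q)
  case 0
  then obtain c where "q = [:c:]" by (metis degree_eq_zeroE)
  then show ?case using laurent_approx_const[of "1 / c"] by simp
next
  case (Suc d)
  then have "\<not> constant (poly q)" by (simp add: constant_degree)
  then obtain a where a: "poly q a = 0" using fundamental_theorem_of_algebra by blast
  then obtain s where s: "q = [:- a, 1:] * s" by (auto simp: poly_eq_0_iff_dvd dvd_def)
  have "s \<noteq> 0" using Suc.hyps(2) s by auto
  then have "degree q = Suc (degree s)" unfolding s by (subst degree_mult_eq) auto
  then have "laurent_approx (\<lambda>z. 1 / poly s z)"
    using Suc.prems Suc.hyps(2) by (intro Suc.hyps(1)) (auto simp: s)
  moreover have "laurent_approx (\<lambda>z. 1 / (z - a))"
    using a Suc.prems by (intro laurent_approx_inverse_linear) blast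
  ultimately have "laurent_approx (\<lambda>z. 1 / (z - a) * (1 / poly s z))" by (rule laurent_approx_mult[rotated])
  then show ?case by (rule laurent_approx_cong) (simp add: s left_diff_distrib)
qed

lemma rational_laurent_approx:
  assumes "f \<in> rational_functions K" shows "laurent_approx f"
proof -
  obtain p q where f: "f = (\<lambda>z. poly p z / poly q z)" and q: "\<forall>z\<in>K. poly q z \<noteq> 0"
    using assms by (auto simp: rational_functions_def)
  have "laurent_approx (\<lambda>z. poly p z * (1 / poly q z))"
    by (intro laurent_approx_mult laurent_approx_polynomial laurent_approx_inverse_polynomial q)
  then show ?thesis by (rule laurent_approx_cong) (simp add: f)
qed

lemma rational_continuous: "f \<in> rational_functions K \<Longrightarrow> continuous_on K f"
  unfolding rational_functions_def by (auto intro!: continuous_intros)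

text \<open>
  The converse of the approximation: a Laurent polynomial is a quotient with a power of \<open>z\<close> as denominator.
\<close>

lemma laurent_poly_rational:
  assumes "p \<in> laurent_polys"
  shows "\<exists>f\<in>rational_functions K. \<forall>z\<in>K. f z = p z"
proof -
  obtain A c where A: "finite A" and p: "p = (\<lambda>z. \<Sum>j\<in>A. c j * zpow j z)"
    using assms by (auto simp: laurent_polys_def)
  have "\<exists>a b. \<forall>z\<in>K. poly b z \<noteq> 0 \<and> poly a z / poly b z = (\<Sum>j\<in>A. c j * zpow j z)"
    using A
  proof (induction A rule: finite_induct)
    case empty
    show ?case by (rule exI[of _ 0], rule exI[of _ 1]) simp
  next
    case (insert j A)
    then obtain a b where ab: "\<And>z. z \<in> K \<Longrightarrow> poly b z \<noteq> 0"
      "\<And>z. z \<in> K \<Longrightarrow> poly a z / poly b z = (\<Sum>j\<in>A. c j * zpow j z)" by blast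
    define u :: "complex poly" where "u = monom (c j) (nat j)"
    define v :: "complex poly" where "v = monom 1 (nat (- j))"
    have v: "poly v z \<noteq> 0" if "z \<in> K" for z
      using K_nonzero[OF that] by (simp add: v_def poly_monom)
    have uv: "poly u z / poly v z = c j * zpow j z" for z
      by (simp add: u_def v_def poly_monom zpow_def power_int_def divide_inverse power_inverse)
    have "poly (b * v) z \<noteq> 0 \<and> poly (a * v + u * b) z / poly (b * v) z = (\<Sum>j\<in>insert j A. c j * zpow j z)"
      if z: "z \<in> K" for z
    proof -
      have "poly (a * v + u * b) z / poly (b * v) z = poly a z / poly b z + poly u z / poly v z"
        using ab(1)[OF z] v[OF z] by (simp add: field_simps)
      then show ?thesis using ab[OF z] v[OF z] uv insert.hyps by (simp add: add.commute)
    qed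
    then show ?case by blast
  qed
  then obtain a b where "\<And>z. z \<in> K \<Longrightarrow> poly b z \<noteq> 0"
    "\<And>z. z \<in> K \<Longrightarrow> poly a z / poly b z = p z" unfolding p by blast
  then show ?thesis
    by (intro bexI[of _ "\<lambda>z. poly a z / poly b z"]) (auto simp: rational_functions_def)
qed

text \<open>
  The square-integrable functions whose classes form the Bergman space, see
  \<open>ae_class_in_bergman_space_iff\<close>. Laurent polynomials replace the rational functions here because their
  inner products with monomials are explicit.
\<close>

definition bergman :: "(complex \<Rightarrow> complex) set" where
  "bergman = {f \<in> square_integrable M. \<forall>e>0. \<exists>p\<in>laurent_polys. fun_norm M (\<lambda>z. f z - p z) < e}"

lemma bergman_square_integrable: "f \<in> bergman \<Longrightarrow> f \<in> square_integrable M"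
  by (simp add: bergman_def)

lemma laurent_poly_bergman: "p \<in> laurent_polys \<Longrightarrow> p \<in> bergman"
  unfolding bergman_def
  by (auto simp: laurent_polys_square_integrable fun_norm_def intro!: bexI[of _ p])

lemma ae_class_cong_K: "(\<And>z. z \<in> K \<Longrightarrow> f z = g z) \<Longrightarrow> ae_class M f = ae_class M g"
  using annulus_subset by (intro ae_class_cong AE_I2) auto

lemma ae_class_in_bergman_space_iff:
  assumes f: "f \<in> square_integrable M"
  shows "ae_class M f \<in> bergman_space r \<longleftrightarrow> f \<in> bergman"
proof
  assume L: "ae_class M f \<in> bergman_space r"
  show "f \<in> bergman" unfolding bergman_def
  proof (intro CollectI conjI f allI impI)
    fix e :: real assume e: "e > 0"
    then obtain g where g: "g \<in> rational_functions K" "l2_dist M (ae_class M f) (ae_class M g) < e / 2"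
      using L unfolding bergman_space_def l2_closure_def closure_annulus
      by (auto dest!: spec[of _ "e / 2"])
    have gs: "g \<in> square_integrable M"
      by (intro continuous_on_K_square_integrable rational_continuous g)
    define C where "C = fun_norm M (\<lambda>z. 1) + 1"
    have C: "C > 0" by (simp add: C_def add_nonneg_pos)
    then have "e / (2 * C) > 0" using e by simp
    then obtain p where p: "p \<in> laurent_polys" "\<And>z. z \<in> K \<Longrightarrow> cmod (g z - p z) < e / (2 * C)"
      using rational_laurent_approx[OF g(1)] unfolding laurent_approx_def by meson
    have ps: "p \<in> square_integrable M" by (rule laurent_polys_square_integrable[OF p(1)])
    have "fun_norm M (\<lambda>z. g z - p z) \<le> e / (2 * C) * fun_norm M (\<lambda>z. 1)"
      using p(2) e C by (intro fun_norm_le_sup square_integrable_diff gs ps) (auto intro: less_imp_le)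
    also have "\<dots> \<le> e / (2 * C) * C" using e C by (intro mult_left_mono) (auto simp: C_def)
    also have "\<dots> = e / 2" using C by simp
    finally have "fun_norm M (\<lambda>z. f z - p z) < e"
      using fun_norm_diff_triangle[OF f gs ps] g(2) l2_dist_eq_fun_norm[OF f gs] by simp
    then show "\<exists>p\<in>laurent_polys. fun_norm M (\<lambda>z. f z - p z) < e" using p(1) by blast
  qed
next
  assume B: "f \<in> bergman"
  show "ae_class M f \<in> bergman_space r"
    unfolding bergman_space_def l2_closure_def closure_annulus
  proof (intro CollectI conjI allI impI)
    show "ae_class M f \<in> L2 M" using f by (simp add: L2_def)
    fix e :: real assume "e > 0"
    then obtain p where p: "p \<in> laurent_polys" "fun_norm M (\<lambda>z. f z - p z) < e"
      using B by (auto simp: bergman_def)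
    obtain g where g: "g \<in> rational_functions K" "\<And>z. z \<in> K \<Longrightarrow> g z = p z"
      using laurent_poly_rational[OF p(1)] by blast
    have gp: "ae_class M g = ae_class M p" by (rule ae_class_cong_K) (rule g(2))
    have "l2_dist M (ae_class M f) (ae_class M g) < e"
      unfolding gp using p(2) l2_dist_eq_fun_norm[OF f laurent_polys_square_integrable[OF p(1)]] by simp
    then show "\<exists>G\<in>ae_class M ` rational_functions K. l2_dist M (ae_class M f) G < e"
      using g(1) by blast
  qed
qed

section \<open>Laurent coefficients in the Bergman space\<close>

text \<open>
  The Fourier coefficient of \<open>f\<close> with respect to the orthogonal system of monomials. It is normalised so
  that it is the coefficient of \<open>z\<^sup>j\<close> if \<open>f\<close> is a Laurent polynomial.
\<close>

definition lcoeff :: "(complex \<Rightarrow> complex) \<Rightarrow> int \<Rightarrow> complex" where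
  "lcoeff f j = fun_inner M f (zpow j) / of_real (\<omega> j)"

definition laurent_sum :: "int set \<Rightarrow> (int \<Rightarrow> complex) \<Rightarrow> complex \<Rightarrow> complex" where
  "laurent_sum A c z = (\<Sum>j\<in>A. c j * zpow j z)"

lemma weight_nonneg [simp]: "0 \<le> (cmod c)\<^sup>2 * \<omega> j"
  using \<omega>_pos[of j] by simp

lemma fun_inner_zpow_right: "fun_inner M f (zpow j) = lcoeff f j * of_real (\<omega> j)"
  using \<omega>_pos[of j] by (simp add: lcoeff_def)

lemma laurent_sum_laurent: "finite A \<Longrightarrow> laurent_sum A c \<in> laurent_polys"
  unfolding laurent_sum_def[abs_def] by (rule laurent_polys_sum)

lemma laurent_sum_square_integrable [simp]: "finite A \<Longrightarrow> laurent_sum A c \<in> square_integrable M"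
  by (intro laurent_polys_square_integrable laurent_sum_laurent)

lemma fun_inner_laurent_sum_left:
  assumes "h \<in> square_integrable M"
  shows "fun_inner M (laurent_sum A c) h = (\<Sum>j\<in>A. c j * fun_inner M (zpow j) h)"
  unfolding laurent_sum_def[abs_def]
  by (subst fun_inner_sum_left) (auto simp: fun_inner_scale_left assms intro!: square_integrable_scale)

lemma fun_inner_laurent_sum_zpow: "finite A \<Longrightarrow> fun_inner M (laurent_sum A c) (zpow j) = (if j \<in> A then c j * of_real (\<omega> j) else 0)"
proof -
  assume "finite A"
  have "fun_inner M (laurent_sum A c) (zpow j) = (\<Sum>i\<in>A. c i * fun_inner M (zpow i) (zpow j))"
    by (rule fun_inner_laurent_sum_left) simp
  also have "\<dots> = (\<Sum>i\<in>A. if i = j then c i * of_real (\<omega> j) else 0)"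
    by (intro sum.cong) (auto simp: fun_inner_zpow)
  finally show ?thesis using \<open>finite A\<close> by (simp add: sum.delta)
qed

lemma fun_norm_square_laurent_sum:
  assumes "finite A"
  shows "(fun_norm M (laurent_sum A c))\<^sup>2 = (\<Sum>j\<in>A. (cmod (c j))\<^sup>2 * \<omega> j)"
proof -
  have "fun_inner M (laurent_sum A c) (laurent_sum A c) = (\<Sum>j\<in>A. c j * fun_inner M (zpow j) (laurent_sum A c))"
    using assms by (intro fun_inner_laurent_sum_left) simp
  also have "\<dots> = (\<Sum>j\<in>A. of_real ((cmod (c j))\<^sup>2 * \<omega> j))"
    using assms
    by (intro sum.cong refl) (simp add: fun_inner_laurent_sum_zpow cnj_fun_inner[symmetric, of M "zpow _"]
        complex_norm_square[symmetric] del: of_real_power)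
  finally show ?thesis unfolding fun_inner_self by (simp flip: of_real_sum del: of_real_mult of_real_power)
qed

text \<open>
  Completing the square. Among all Laurent polynomials with exponents in \<open>A\<close>, the one with the
  coefficients of \<open>f\<close> is thus closest to \<open>f\<close>.
\<close>

lemma fun_norm_square_diff_laurent_sum:
  assumes f: "f \<in> square_integrable M" and A: "finite A"
  shows "(fun_norm M (\<lambda>z. f z - laurent_sum A c z))\<^sup>2
    = (fun_norm M f)\<^sup>2 - (\<Sum>j\<in>A. (cmod (lcoeff f j))\<^sup>2 * \<omega> j) + (\<Sum>j\<in>A. (cmod (lcoeff f j - c j))\<^sup>2 * \<omega> j)"
proof -
  have "fun_inner M f (laurent_sum A c) = cnj (fun_inner M (laurent_sum A c) f)" by (simp add: cnj_fun_inner)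
  also have "\<dots> = (\<Sum>j\<in>A. lcoeff f j * cnj (c j) * of_real (\<omega> j))"
    by (simp add: fun_inner_laurent_sum_left[OF f] cnj_fun_inner fun_inner_zpow_right mult_ac)
  finally have 1: "Re (fun_inner M f (laurent_sum A c)) = (\<Sum>j\<in>A. Re (lcoeff f j * cnj (c j)) * \<omega> j)"
    by simp
  have 2: "(cmod (a - b))\<^sup>2 = (cmod a)\<^sup>2 - 2 * Re (a * cnj b) + (cmod b)\<^sup>2" for a b
    unfolding cmod_power2 by (simp add: power2_eq_square algebra_simps)
  show ?thesis
    unfolding fun_norm_square_diff[OF f laurent_sum_square_integrable[OF A]] 1 fun_norm_square_laurent_sum[OF A] 2
    by (simp add: algebra_simps sum.distrib sum_subtractf sum_distrib_left)
qed

lemma fun_norm_square_diff_partial: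
  assumes f: "f \<in> square_integrable M" and A: "finite A"
  shows "(fun_norm M (\<lambda>z. f z - laurent_sum A (lcoeff f) z))\<^sup>2 = (fun_norm M f)\<^sup>2 - (\<Sum>j\<in>A. (cmod (lcoeff f j))\<^sup>2 * \<omega> j)"
  using fun_norm_square_diff_laurent_sum[OF assms, of "lcoeff f"] by simp

text \<open>
  Some Laurent polynomial is close to \<open>f\<close>. The partial sum with the same exponents is at least as close,
  and further exponents only decrease the distance.
\<close>

lemma bergman_partial_sums:
  assumes f: "f \<in> bergman" and e: "e > 0"
  obtains X where "finite X"
    "\<And>Y. finite Y \<Longrightarrow> X \<subseteq> Y \<Longrightarrow> fun_norm M (\<lambda>z. f z - laurent_sum Y (lcoeff f) z) < e"
proof -
  have fs: "f \<in> square_integrable M" using f by (rule bergman_square_integrable)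
  obtain p where p: "p \<in> laurent_polys" "fun_norm M (\<lambda>z. f z - p z) < e"
    using f e by (auto simp: bergman_def)
  then obtain X c where X: "finite X" and pX: "p = laurent_sum X c"
    by (auto simp: laurent_polys_def laurent_sum_def[abs_def])
  have "fun_norm M (\<lambda>z. f z - laurent_sum Y (lcoeff f) z) < e" if Y: "finite Y" "X \<subseteq> Y" for Y
  proof -
    have "(\<Sum>j\<in>X. (cmod (lcoeff f j))\<^sup>2 * \<omega> j) \<le> (\<Sum>j\<in>Y. (cmod (lcoeff f j))\<^sup>2 * \<omega> j)"
      using Y by (intro sum_mono2) auto
    moreover have "(\<Sum>j\<in>X. (cmod (lcoeff f j - c j))\<^sup>2 * \<omega> j) \<ge> 0"
      by (intro sum_nonneg) simp
    ultimately have "(fun_norm M (\<lambda>z. f z - laurent_sum Y (lcoeff f) z))\<^sup>2 \<le> (fun_norm M (\<lambda>z. f z - p z))\<^sup>2"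
      unfolding fun_norm_square_diff_partial[OF fs Y(1)] pX fun_norm_square_diff_laurent_sum[OF fs X] by simp
    then have "fun_norm M (\<lambda>z. f z - laurent_sum Y (lcoeff f) z) \<le> fun_norm M (\<lambda>z. f z - p z)"
      by (rule power2_le_imp_le) simp
    then show ?thesis using p(2) by simp
  qed
  then show thesis using that X by blast
qed

lemma parseval:
  assumes f: "f \<in> bergman"
  shows "((\<lambda>j. (cmod (lcoeff f j))\<^sup>2 * \<omega> j) has_sum (fun_norm M f)\<^sup>2) UNIV"
proof (rule has_sum_approxI)
  fix e :: real assume "e > 0"
  then obtain X where X: "finite X"
    "\<And>Y. finite Y \<Longrightarrow> X \<subseteq> Y \<Longrightarrow> fun_norm M (\<lambda>z. f z - laurent_sum Y (lcoeff f) z) < sqrt e"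
    using bergman_partial_sums[OF f, of "sqrt e"] by auto
  have "norm ((\<Sum>j\<in>Y. (cmod (lcoeff f j))\<^sup>2 * \<omega> j) - (fun_norm M f)\<^sup>2) < e" if Y: "finite Y" "X \<subseteq> Y" for Y
  proof -
    have "(fun_norm M (\<lambda>z. f z - laurent_sum Y (lcoeff f) z))\<^sup>2 < (sqrt e)\<^sup>2"
      by (intro power_strict_mono X(2)[OF Y]) auto
    then have "(fun_norm M f)\<^sup>2 - (\<Sum>j\<in>Y. (cmod (lcoeff f j))\<^sup>2 * \<omega> j) < e"
      using fun_norm_square_diff_partial[OF bergman_square_integrable[OF f] Y(1)] \<open>e > 0\<close> by simp
    moreover have "(fun_norm M f)\<^sup>2 - (\<Sum>j\<in>Y. (cmod (lcoeff f j))\<^sup>2 * \<omega> j) \<ge> 0"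
      using fun_norm_square_diff_partial[OF bergman_square_integrable[OF f] Y(1)] 
        zero_le_power2[of "fun_norm M (\<lambda>z. f z - laurent_sum Y (lcoeff f) z)"] by linarith
    ultimately show ?thesis unfolding real_norm_def by linarith
  qed
  then show "\<exists>X. finite X \<and> (\<forall>Y. finite Y \<longrightarrow> X \<subseteq> Y \<longrightarrow>
      norm ((\<Sum>j\<in>Y. (cmod (lcoeff f j))\<^sup>2 * \<omega> j) - (fun_norm M f)\<^sup>2) < e)"
    using X(1) by blast
qed

text \<open>
  By the Cauchy-Schwarz inequality the inner product with a fixed function is continuous, so it can be
  computed along the partial sums. The function \<open>g\<close> is arbitrary, which \<open>lcoeff_mult_pow\<close> uses for a \<open>g\<close>
  outside the Bergman space.
\<close>

lemma fun_inner_expansion: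
  assumes f: "f \<in> bergman" and g: "g \<in> square_integrable M"
  shows "((\<lambda>j. lcoeff f j * fun_inner M (zpow j) g) has_sum fun_inner M f g) UNIV"
proof (rule has_sum_approxI)
  fix e :: real assume e: "e > 0"
  define C where "C = fun_norm M g + 1"
  have C: "C > 0" by (simp add: C_def add_nonneg_pos)
  have fs: "f \<in> square_integrable M" using f by (rule bergman_square_integrable)
  obtain X where X: "finite X"
    "\<And>Y. finite Y \<Longrightarrow> X \<subseteq> Y \<Longrightarrow> fun_norm M (\<lambda>z. f z - laurent_sum Y (lcoeff f) z) < e / C"
    using bergman_partial_sums[OF f, of "e / C"] e C by auto
  have "norm ((\<Sum>j\<in>Y. lcoeff f j * fun_inner M (zpow j) g) - fun_inner M f g) < e" if Y: "finite Y" "X \<subseteq> Y" for Y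
  proof -
    have ps: "laurent_sum Y (lcoeff f) \<in> square_integrable M" using Y by simp
    have "norm ((\<Sum>j\<in>Y. lcoeff f j * fun_inner M (zpow j) g) - fun_inner M f g) = cmod (fun_inner M (\<lambda>z. f z - laurent_sum Y (lcoeff f) z) g)"
      by (simp add: fun_inner_diff_left[OF fs ps g] fun_inner_laurent_sum_left[OF g] norm_minus_commute)
    also have "\<dots> \<le> fun_norm M (\<lambda>z. f z - laurent_sum Y (lcoeff f) z) * fun_norm M g"
      by (intro cmod_fun_inner_le square_integrable_diff fs ps g)
    also have "\<dots> \<le> fun_norm M (\<lambda>z. f z - laurent_sum Y (lcoeff f) z) * C"
      by (intro mult_left_mono) (auto simp: C_def)
    also have "\<dots> < e / C * C" by (intro mult_strict_right_mono X(2) Y C)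
    finally show ?thesis using C by simp
  qed
  then show "\<exists>X. finite X \<and> (\<forall>Y. finite Y \<longrightarrow> X \<subseteq> Y \<longrightarrow>
      norm ((\<Sum>j\<in>Y. lcoeff f j * fun_inner M (zpow j) g) - fun_inner M f g) < e)"
    using X(1) by blast
qed

lemma fun_norm_scale: "fun_norm M (\<lambda>z. c * f z) = cmod c * fun_norm M f"
  by (simp add: fun_norm_def norm_mult power_mult_distrib real_sqrt_mult)

lemma bergman_scale:
  assumes f: "f \<in> bergman" shows "(\<lambda>z. c * f z) \<in> bergman"
  unfolding bergman_def
proof (intro CollectI conjI allI impI)
  show "(\<lambda>z. c * f z) \<in> square_integrable M"
    by (intro square_integrable_scale bergman_square_integrable f)
  fix e :: real assume e: "e > 0"
  define C where "C = cmod c + 1"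
  have C: "C > 0" by (simp add: C_def add_nonneg_pos)
  then have "e / C > 0" using e by simp
  then obtain p where p: "p \<in> laurent_polys" "fun_norm M (\<lambda>z. f z - p z) < e / C"
    using f unfolding bergman_def by blast
  have "fun_norm M (\<lambda>z. c * f z - c * p z) = cmod c * fun_norm M (\<lambda>z. f z - p z)"
    by (simp flip: fun_norm_scale right_diff_distrib)
  also have "\<dots> \<le> C * fun_norm M (\<lambda>z. f z - p z)" by (intro mult_right_mono) (auto simp: C_def)
  also have "\<dots> < C * (e / C)" by (intro mult_strict_left_mono p C)
  finally have "fun_norm M (\<lambda>z. c * f z - c * p z) < e" using C by simp
  then show "\<exists>q\<in>laurent_polys. fun_norm M (\<lambda>z. c * f z - q z) < e"
    using laurent_polys_scale[OF p(1)] by (intro bexI[of _ "\<lambda>z. c * p z"])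
qed

lemma bergman_add:
  assumes f: "f \<in> bergman" and g: "g \<in> bergman"
  shows "(\<lambda>z. f z + g z) \<in> bergman"
  unfolding bergman_def
proof (intro CollectI conjI allI impI)
  have fs: "f \<in> square_integrable M" and gs: "g \<in> square_integrable M"
    using f g by (auto intro: bergman_square_integrable)
  show "(\<lambda>z. f z + g z) \<in> square_integrable M" by (intro square_integrable_add fs gs)
  fix e :: real assume "e > 0"
  then have "e / 2 > 0" by simp
  then obtain p q where p: "p \<in> laurent_polys" "fun_norm M (\<lambda>z. f z - p z) < e / 2"
    and q: "q \<in> laurent_polys" "fun_norm M (\<lambda>z. g z - q z) < e / 2"
    using f g unfolding bergman_def by blast
  have ps: "p \<in> square_integrable M" "q \<in> square_integrable M"
    using p q by (auto intro: laurent_polys_square_integrable)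
  have "fun_norm M (\<lambda>z. f z + g z - (p z + q z)) = fun_norm M (\<lambda>z. (f z - p z) - (q z - g z))"
    by (simp add: algebra_simps)
  also have "\<dots> \<le> fun_norm M (\<lambda>z. (f z - p z) - 0) + fun_norm M (\<lambda>z. 0 - (q z - g z))"
    by (intro fun_norm_diff_triangle square_integrable_diff fs gs ps square_integrable_zero)
  also have "\<dots> = fun_norm M (\<lambda>z. f z - p z) + fun_norm M (\<lambda>z. g z - q z)" by simp
  finally show "\<exists>s\<in>laurent_polys. fun_norm M (\<lambda>z. f z + g z - s z) < e"
    using p(2) q(2) laurent_polys_add[OF p(1) q(1)] by (intro bexI[of _ "\<lambda>z. p z + q z"]) auto
qed

lemma bergman_diff:
  "f \<in> bergman \<Longrightarrow> g \<in> bergman \<Longrightarrow> (\<lambda>z. f z - g z) \<in> bergman"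
  using bergman_add[OF _ bergman_scale, of f g "-1"] by simp

lemma lcoeff_diff:
  "f \<in> square_integrable M \<Longrightarrow> g \<in> square_integrable M \<Longrightarrow> lcoeff (\<lambda>z. f z - g z) j = lcoeff f j - lcoeff g j"
  by (simp add: lcoeff_def fun_inner_diff_left diff_divide_distrib)

lemma bergman_eqI:
  assumes f: "f \<in> bergman" and g: "g \<in> bergman" and eq: "\<And>j. lcoeff f j = lcoeff g j"
  shows "ae_class M f = ae_class M g"
proof -
  have fs: "f \<in> square_integrable M" and gs: "g \<in> square_integrable M"
    using f g by (auto intro: bergman_square_integrable)
  have "((\<lambda>j. 0) has_sum (fun_norm M (\<lambda>z. f z - g z))\<^sup>2) (UNIV :: int set)"
    using parseval[OF bergman_diff[OF f g]] by (simp add: lcoeff_diff[OF fs gs] eq)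
  then have "(fun_norm M (\<lambda>z. f z - g z))\<^sup>2 = 0" by (rule has_sum_unique) simp
  then have "(LINT z|M. (cmod (f z - g z))\<^sup>2) = 0" by (simp only: fun_norm_square)
  moreover have "integrable M (\<lambda>z. (cmod (f z - g z))\<^sup>2)"
    using square_integrable_diff[OF fs gs] by (simp add: square_integrable_def)
  ultimately have "AE z in M. (cmod (f z - g z))\<^sup>2 = 0"
    by (subst (asm) integral_nonneg_eq_0_iff_AE) auto
  then show ?thesis by (intro ae_class_cong) auto
qed

text \<open>
  Surjectivity of the coefficient map. Partial sums along index sets that miss less than \<open>4\<^sup>-\<^sup>k\<close> of the
  total have steps of norm at most \<open>2\<^sup>-\<^sup>k\<close>, as \<open>L2_complete\<close> requires.
\<close>

lemma riesz_fischer: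
  assumes c: "(\<lambda>j. (cmod (c j))\<^sup>2 * \<omega> j) summable_on UNIV"
  shows "\<exists>f\<in>bergman. \<forall>j. lcoeff f j = c j"
proof -
  let ?t = "\<lambda>j. (cmod (c j))\<^sup>2 * \<omega> j"
  have nn: "?t j \<ge> 0" for j using \<omega>_pos[of j] by simp
  define S where "S = infsum ?t UNIV"
  have S: "(?t has_sum S) UNIV" using c by (simp add: S_def)
  have le: "sum ?t Y \<le> S" if "finite Y" for Y
    by (rule finite_sum_le_has_sum[OF S]) (use that nn in auto)
  have "\<exists>X. finite X \<and> S - sum ?t X < e" if e: "e > 0" for e
  proof -
    have "eventually (\<lambda>Y. dist (sum ?t Y) S < e) (finite_subsets_at_top UNIV)"
      using S e unfolding has_sum_def by (rule tendstoD)
    then obtain X where "finite X" "dist (sum ?t X) S < e"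
      unfolding eventually_finite_subsets_at_top by auto
    then show ?thesis by (auto simp: dist_real_def)
  qed
  then have "\<forall>k. \<exists>X. finite X \<and> S - sum ?t X < (1/4) ^ k" by simp
  then obtain X where X: "\<And>k. finite (X k)" "\<And>k. S - sum ?t (X k) < (1/4) ^ k" by metis
  \<comment> \<open>The unions make the index sets increasing; the intervals ensure that each index is reached.\<close>
  define A where "A k = (\<Union>i\<le>k. X i) \<union> {- int k..int k}" for k
  have A: "finite (A k)" for k using X by (simp add: A_def)
  have AS: "A k \<subseteq> A (Suc k)" for k unfolding A_def by (force simp: atMost_Suc)
  have At: "S - sum ?t (A k) < (1/4) ^ k" for k
  proof -
    have "sum ?t (X k) \<le> sum ?t (A k)" by (intro sum_mono2 A nn) (auto simp: A_def)
    then show ?thesis using X(2)[of k] by linarith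
  qed
  have step: "fun_norm M (\<lambda>z. laurent_sum (A (Suc k)) c z - laurent_sum (A k) c z) \<le> (1/2) ^ k" for k
  proof (rule power2_le_imp_le)
    have "(\<lambda>z. laurent_sum (A (Suc k)) c z - laurent_sum (A k) c z) = laurent_sum (A (Suc k) - A k) c"
      unfolding laurent_sum_def[abs_def] by (simp add: sum_diff[OF A AS])
    then have "(fun_norm M (\<lambda>z. laurent_sum (A (Suc k)) c z - laurent_sum (A k) c z))\<^sup>2 = sum ?t (A (Suc k) - A k)"
      using A by (simp add: fun_norm_square_laurent_sum)
    also have "\<dots> = sum ?t (A (Suc k)) - sum ?t (A k)" by (rule sum_diff[OF A AS])
    also have "\<dots> \<le> (1/4) ^ k" using le[OF A, of "Suc k"] At[of k] by linarith
    also have "\<dots> = ((1/2) ^ k)\<^sup>2" by (simp add: power2_eq_square flip: power_mult_distrib)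
    finally show "(fun_norm M (\<lambda>z. laurent_sum (A (Suc k)) c z - laurent_sum (A k) c z))\<^sup>2 \<le> ((1/2) ^ k)\<^sup>2" .
  qed simp
  from L2_complete[OF finite_M laurent_sum_square_integrable[OF A] step]
  obtain f where f: "f \<in> square_integrable M"
    and lim: "(\<lambda>k. fun_norm M (\<lambda>z. f z - laurent_sum (A k) c z)) \<longlonglongrightarrow> 0" by blast
  have "f \<in> bergman" unfolding bergman_def
  proof (intro CollectI conjI allI impI f)
    fix e :: real assume "e > 0"
    then have "eventually (\<lambda>k. fun_norm M (\<lambda>z. f z - laurent_sum (A k) c z) < e) sequentially"
      using lim by (intro order_tendstoD)
    then obtain k where "fun_norm M (\<lambda>z. f z - laurent_sum (A k) c z) < e" by (auto simp: eventually_sequentially)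
    then show "\<exists>p\<in>laurent_polys. fun_norm M (\<lambda>z. f z - p z) < e"
      using laurent_sum_laurent[OF A] by blast
  qed
  moreover have "lcoeff f j = c j" for j
  proof -
    have "(\<lambda>k. fun_norm M (\<lambda>z. f z - laurent_sum (A k) c z) * fun_norm M (zpow j)) \<longlonglongrightarrow> 0"
      by (intro tendsto_mult_left_zero lim)
    moreover have "eventually (\<lambda>k. norm (fun_inner M f (zpow j) - c j * of_real (\<omega> j))
        \<le> fun_norm M (\<lambda>z. f z - laurent_sum (A k) c z) * fun_norm M (zpow j)) sequentially"
      using eventually_ge_at_top[of "nat \<bar>j\<bar>"]
    proof eventually_elim
      case (elim k)
      then have j: "j \<in> A k" by (auto simp: A_def)
      have "fun_inner M f (zpow j) - c j * of_real (\<omega> j) = fun_inner M (\<lambda>z. f z - laurent_sum (A k) c z) (zpow j)"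
        using A j by (simp add: fun_inner_diff_left f fun_inner_laurent_sum_zpow)
      then show ?case
        using cmod_fun_inner_le[OF square_integrable_diff[OF f laurent_sum_square_integrable[OF A]] zpow_square_integrable]
        by simp
    qed
    ultimately have "norm (fun_inner M f (zpow j) - c j * of_real (\<omega> j)) \<le> 0"
      by (intro tendsto_lowerbound) auto
    then show ?thesis using \<omega>_pos[of j] by (simp add: lcoeff_def)
  qed
  ultimately show ?thesis by (intro bexI[of _ f]) auto
qed

lemma fun_norm_mono:
  assumes "f \<in> square_integrable M" "g \<in> square_integrable M"
    and "\<And>z. z \<in> K \<Longrightarrow> cmod (f z) \<le> cmod (g z)"
  shows "fun_norm M f \<le> fun_norm M g"
  unfolding fun_norm_def
proof (intro real_sqrt_le_mono integral_mono)
  fix z assume "z \<in> space M"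
  then show "(cmod (f z))\<^sup>2 \<le> (cmod (g z))\<^sup>2"
    using assms(3) annulus_subset by (auto intro!: power_mono)
qed (use assms in \<open>auto simp: square_integrable_def\<close>)

lemma power_eq_zpow: "z ^ n = zpow (int n) z"
  by (simp add: zpow_def)

lemma mult_pow_square_integrable:
  assumes "f \<in> square_integrable M" shows "(\<lambda>z. z ^ n * f z) \<in> square_integrable M"
proof (rule square_integrable_mult_bounded[OF assms, where B = 1])
  show "(\<lambda>z. z ^ n) \<in> borel_measurable M"
    by (intro continuous_imp_measurable continuous_intros)
  show "cmod (z ^ n) \<le> 1" if "z \<in> space M" for z
    using that by (auto simp: annulus_def norm_power intro!: power_le_one)
qed

lemma mult_pow_bergman:
  assumes f: "f \<in> bergman" shows "(\<lambda>z. z ^ n * f z) \<in> bergman"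
  unfolding bergman_def
proof (intro CollectI conjI allI impI)
  have fs: "f \<in> square_integrable M" using f by (rule bergman_square_integrable)
  show ns: "(\<lambda>z. z ^ n * f z) \<in> square_integrable M" using fs by (rule mult_pow_square_integrable)
  fix e :: real assume "e > 0"
  then obtain p where p: "p \<in> laurent_polys" "fun_norm M (\<lambda>z. f z - p z) < e"
    using f by (auto simp: bergman_def)
  obtain q where q: "q \<in> laurent_polys" "\<And>z. z \<in> K \<Longrightarrow> q z = (1 * zpow (int n) z) * p z"
    using laurent_polys_mult[OF laurent_polys_monomial[of 1 "int n"] p(1)] by blast
  have "fun_norm M (\<lambda>z. z ^ n * f z - q z) \<le> fun_norm M (\<lambda>z. f z - p z)"
  proof (rule fun_norm_mono)
    fix z assume z: "z \<in> K"
    have "z ^ n * f z - q z = z ^ n * (f z - p z)"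
      by (simp add: q(2)[OF z] power_eq_zpow[symmetric] algebra_simps)
    then show "cmod (z ^ n * f z - q z) \<le> cmod (f z - p z)"
      using z by (simp add: norm_mult norm_power mult_left_le_one_le power_le_one)
  qed (intro square_integrable_diff ns fs laurent_polys_square_integrable p q)+
  then show "\<exists>p\<in>laurent_polys. fun_norm M (\<lambda>z. z ^ n * f z - p z) < e"
    using p(2) q(1) by (intro bexI[of _ q]) auto
qed

lemma fun_inner_cong_K:
  "(\<And>z. z \<in> K \<Longrightarrow> f z * cnj (g z) = h z * cnj (k z)) \<Longrightarrow> fun_inner M f g = fun_inner M h k"
  unfolding fun_inner_def using annulus_subset by (intro Bochner_Integration.integral_cong) auto

text \<open>
  Move the factor \<open>z\<^sup>n\<close> to the other side of the inner product, where it turns the monomial into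
  \<open>cnj (z ^ n) * z powi j\<close>, and expand \<open>f\<close>: only the exponent \<open>j - n\<close> survives.
\<close>

lemma lcoeff_mult_pow:
  assumes f: "f \<in> bergman"
  shows "lcoeff (\<lambda>z. z ^ n * f z) j = lcoeff f (j - int n)"
proof -
  define g where "g = (\<lambda>z. cnj (z ^ n) * zpow j z)"
  have gs: "g \<in> square_integrable M"
    unfolding g_def
    by (intro continuous_on_K_square_integrable continuous_intros continuous_on_zpow)
  have 1: "fun_inner M (\<lambda>z. z ^ n * f z) (zpow j) = fun_inner M f g"
    by (rule fun_inner_cong_K) (simp add: g_def mult_ac)
  have 2: "fun_inner M (zpow i) g = (if i = j - int n then of_real (\<omega> j) else 0)" for i
  proof -
    have "fun_inner M (zpow i) g = fun_inner M (zpow (i + int n)) (zpow j)"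
      by (rule fun_inner_cong_K) (simp add: g_def zpow_add power_eq_zpow mult_ac)
    then show ?thesis by (auto simp: fun_inner_zpow)
  qed
  have "((\<lambda>i. lcoeff f i * fun_inner M (zpow i) g) has_sum fun_inner M f g) UNIV" by (rule fun_inner_expansion[OF f gs])
  moreover have "((\<lambda>i. lcoeff f i * fun_inner M (zpow i) g) has_sum (lcoeff f (j - int n) * of_real (\<omega> j))) UNIV"
    by (rule has_sum_finite_neutralI[of "{j - int n}"]) (auto simp: 2)
  ultimately have "fun_inner M f g = lcoeff f (j - int n) * of_real (\<omega> j)" by (rule has_sum_unique)
  then show ?thesis using \<omega>_pos[of j] by (simp add: lcoeff_def[of "\<lambda>z. z ^ n * f z"] 1)
qed

text \<open>
  The coefficients of the adjoint are forced by testing against monomials. They are square-summable since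
  the eigenvalues are at most \<open>1\<close>, so \<open>riesz_fischer\<close> provides the function; the identity for general \<open>f\<close>
  is a shift of the summation index.
\<close>

lemma adjoint_exists:
  assumes g: "g \<in> bergman"
  obtains k where "k \<in> bergman" "\<And>j. lcoeff k j = lcoeff g (j + int n) * of_real (eigval n j)"
    "\<And>f. f \<in> bergman \<Longrightarrow> fun_inner M (\<lambda>z. z ^ n * f z) g = fun_inner M f k"
proof -
  let ?c = "\<lambda>j. lcoeff g (j + int n) * of_real (eigval n j)"
  let ?t = "\<lambda>j. (cmod (lcoeff g j))\<^sup>2 * \<omega> j"
  have bij: "bij_betw (\<lambda>j. j + int n) UNIV UNIV"
    by (rule bij_betwI[of _ _ _ "\<lambda>j. j - int n"]) auto
  have "(?t has_sum (fun_norm M g)\<^sup>2) UNIV" by (rule parseval[OF g])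
  then have "((\<lambda>j. ?t (j + int n)) has_sum (fun_norm M g)\<^sup>2) UNIV"
    by (subst has_sum_reindex_bij_betw[OF bij])
  then have "(\<lambda>j. ?t (j + int n)) summable_on UNIV" by (rule has_sum_imp_summable)
  moreover have "(cmod (?c j))\<^sup>2 * \<omega> j \<le> ?t (j + int n)" for j
  proof -
    have "(cmod (?c j))\<^sup>2 * \<omega> j = (cmod (lcoeff g (j + int n)))\<^sup>2 * (eigval n j * (eigval n j * \<omega> j))"
      by (simp add: norm_mult power_mult_distrib power2_eq_square)
    also have "eigval n j * \<omega> j = \<omega> (j + int n)" using \<omega>_pos[of j] by (simp add: eigval_def)
    also have "eigval n j * \<omega> (j + int n) \<le> \<omega> (j + int n)"
      using eigval_bounds[of n j] \<omega>_pos[of "j + int n"] by (intro mult_left_le_one_le) auto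
    finally show ?thesis by (simp add: mult_left_mono)
  qed
  ultimately have "(\<lambda>j. (cmod (?c j))\<^sup>2 * \<omega> j) summable_on UNIV"
    by (rule summable_on_comparison_test) simp
  from riesz_fischer[OF this] obtain k where k: "k \<in> bergman" "\<And>j. lcoeff k j = ?c j" by metis
  have "fun_inner M (\<lambda>z. z ^ n * f z) g = fun_inner M f k" if f: "f \<in> bergman" for f
  proof -
    have zpow_fun_inner: "fun_inner M (zpow j) h = cnj (lcoeff h j) * of_real (\<omega> j)" for h j
      using cnj_fun_inner[of M h "zpow j"] by (simp add: fun_inner_zpow_right)
    have "((\<lambda>j. lcoeff f (j - int n) * (cnj (lcoeff g j) * of_real (\<omega> j))) has_sum fun_inner M (\<lambda>z. z ^ n * f z) g) UNIV"
      using fun_inner_expansion[OF mult_pow_bergman[OF f] bergman_square_integrable[OF g]]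
      by (simp add: lcoeff_mult_pow[OF f] zpow_fun_inner)
    then have "((\<lambda>j. lcoeff f j * (cnj (lcoeff g (j + int n)) * of_real (\<omega> (j + int n))))
        has_sum fun_inner M (\<lambda>z. z ^ n * f z) g) UNIV"
      by (subst (asm) has_sum_reindex_bij_betw[OF bij, symmetric]) simp
    moreover have "of_real (\<omega> (j + int n)) = complex_of_real (eigval n j) * of_real (\<omega> j)" for j
      using \<omega>_pos[of j] by (simp add: eigval_def)
    ultimately have "((\<lambda>j. lcoeff f j * fun_inner M (zpow j) k) has_sum fun_inner M (\<lambda>z. z ^ n * f z) g) UNIV"
      by (simp add: zpow_fun_inner k(2) mult_ac)
    then show ?thesis
      using fun_inner_expansion[OF f bergman_square_integrable[OF k(1)]] by (rule has_sum_unique)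
  qed
  then show thesis using that k by blast
qed

section \<open>Classes of functions, multiplication by $z^n$ and its adjoint\<close>

abbreviation H :: "complex l2 set" where "H \<equiv> bergman_space r"

definition zclass :: "int \<Rightarrow> complex l2" where "zclass j = ae_class M (zpow j)"

definition class_coeff :: "complex l2 \<Rightarrow> int \<Rightarrow> complex" where
  "class_coeff F j = l2_inner M F (zclass j) / of_real (\<omega> j)"

lemma class_coeff_ae_class: "f \<in> square_integrable M \<Longrightarrow> class_coeff (ae_class M f) j = lcoeff f j"
  by (simp add: class_coeff_def zclass_def l2_inner_eq_fun_inner lcoeff_def)

lemma bergman_space_subset_L2: "H \<subseteq> L2 M"
  unfolding bergman_space_def by (rule l2_closure_subset_L2)

lemma ae_class_in_bergman_space: "f \<in> bergman \<Longrightarrow> ae_class M f \<in> H"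
  using ae_class_in_bergman_space_iff bergman_square_integrable by blast

lemma bergman_spaceE:
  assumes "F \<in> H"
  obtains f where "f \<in> bergman" "f \<in> square_integrable M" "F = ae_class M f"
proof -
  obtain f where f: "f \<in> square_integrable M" "F = ae_class M f"
    using assms bergman_space_subset_L2 by (blast elim: L2E)
  then show thesis using that assms ae_class_in_bergman_space_iff by blast
qed

lemma bergman_space_parseval:
  assumes "F \<in> H" "G \<in> H"
  shows "((\<lambda>j. (cmod (class_coeff F j - class_coeff G j))\<^sup>2 * \<omega> j) has_sum (l2_dist M F G)\<^sup>2) UNIV"
proof -
  obtain f where f: "f \<in> bergman" "f \<in> square_integrable M" "F = ae_class M f"
    using assms(1) by (rule bergman_spaceE)
  obtain g where g: "g \<in> bergman" "g \<in> square_integrable M" "G = ae_class M g"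
    using assms(2) by (rule bergman_spaceE)
  note fg = f g
  show ?thesis
    using parseval[OF bergman_diff[OF fg(1,4)]] fg by (simp add: l2_dist_eq_fun_norm class_coeff_ae_class lcoeff_diff)
qed

lemma bergman_space_eqI:
  assumes "F \<in> H" "G \<in> H" "\<And>j. class_coeff F j = class_coeff G j" shows "F = G"
proof -
  obtain f where f: "f \<in> bergman" "f \<in> square_integrable M" "F = ae_class M f"
    using assms(1) by (rule bergman_spaceE)
  obtain g where g: "g \<in> bergman" "g \<in> square_integrable M" "G = ae_class M g"
    using assms(2) by (rule bergman_spaceE)
  note fg = f g
  have "lcoeff f j = lcoeff g j" for j using assms(3)[of j] fg by (simp add: class_coeff_ae_class)
  then show ?thesis using bergman_eqI[OF fg(1,4)] fg(3,6) by simp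
qed

lemma class_coeff_dist_le:
  assumes "F \<in> H" "G \<in> H" shows "(cmod (class_coeff F j - class_coeff G j))\<^sup>2 * \<omega> j \<le> (l2_dist M F G)\<^sup>2"
  using finite_sum_le_has_sum[OF bergman_space_parseval[OF assms], of "{j}"] by simp

lemma bergman_space_add:
  assumes "F \<in> H" "G \<in> H"
  shows "l2_add M F G \<in> H" and "class_coeff (l2_add M F G) j = class_coeff F j + class_coeff G j"
proof -
  obtain f where f: "f \<in> bergman" "f \<in> square_integrable M" "F = ae_class M f"
    using assms(1) by (rule bergman_spaceE)
  obtain g where g: "g \<in> bergman" "g \<in> square_integrable M" "G = ae_class M g"
    using assms(2) by (rule bergman_spaceE)
  note fg = f g
  have eq: "l2_add M F G = ae_class M (\<lambda>z. f z + g z)" using fg by (simp add: l2_add_ae_class)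
  show "l2_add M F G \<in> H" unfolding eq by (intro ae_class_in_bergman_space bergman_add fg)
  show "class_coeff (l2_add M F G) j = class_coeff F j + class_coeff G j" unfolding eq
    using fg by (simp add: class_coeff_ae_class square_integrable_add lcoeff_def fun_inner_add_left add_divide_distrib)
qed

lemma bergman_space_scale:
  assumes "F \<in> H"
  shows "l2_scale M c F \<in> H" and "class_coeff (l2_scale M c F) j = c * class_coeff F j"
proof -
  obtain f where f: "f \<in> bergman" "f \<in> square_integrable M" "F = ae_class M f"
    using assms by (rule bergman_spaceE)
  have eq: "l2_scale M c F = ae_class M (\<lambda>z. c * f z)" using f by (simp add: l2_scale_ae_class)
  show "l2_scale M c F \<in> H" unfolding eq by (intro ae_class_in_bergman_space bergman_scale f)
  show "class_coeff (l2_scale M c F) j = c * class_coeff F j" unfolding eq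
    using f by (simp add: class_coeff_ae_class square_integrable_scale lcoeff_def fun_inner_scale_left)
qed

lemma bergman_space_zero: "l2_zero M \<in> H" and class_coeff_zero: "class_coeff (l2_zero M) j = 0"
proof -
  have "(\<lambda>z. 0) \<in> bergman"
    using laurent_poly_bergman[OF laurent_polys_sum[of "{}"]] by simp
  then show "l2_zero M \<in> H" unfolding l2_zero_def by (rule ae_class_in_bergman_space)
  show "class_coeff (l2_zero M) j = 0" unfolding l2_zero_def by (simp add: class_coeff_ae_class lcoeff_def fun_inner_def)
qed

lemma zclass_in_bergman_space: "zclass j \<in> H"
  unfolding zclass_def using laurent_poly_bergman[OF laurent_polys_monomial[of 1 j]] by (intro ae_class_in_bergman_space) simp

lemma class_coeff_zclass: "class_coeff (zclass i) j = (if i = j then 1 else 0)"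
  unfolding zclass_def using \<omega>_pos[of j] by (simp add: class_coeff_ae_class lcoeff_def fun_inner_zpow)

lemma bergman_space_closed: "l2_closure M H = H"
proof -
  have "ae_class M ` rational_functions K \<subseteq> L2 M"
    by (auto intro!: ae_class_in_L2 continuous_on_K_square_integrable rational_continuous)
  then show ?thesis unfolding bergman_space_def closure_annulus by (rule l2_closure_idem)
qed

lemma bergman_space_mult_pow:
  assumes "F \<in> H"
  shows "mult_pow r n F \<in> H" and "class_coeff (mult_pow r n F) j = class_coeff F (j - int n)"
proof -
  obtain f where f: "f \<in> bergman" "f \<in> square_integrable M" "F = ae_class M f"
    using assms by (rule bergman_spaceE)
  have eq: "mult_pow r n F = ae_class M (\<lambda>z. z ^ n * f z)"
    using f by (simp add: mult_pow_def l2_mult_ae_class)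
  show "mult_pow r n F \<in> H" unfolding eq by (intro ae_class_in_bergman_space mult_pow_bergman f)
  show "class_coeff (mult_pow r n F) j = class_coeff F (j - int n)" unfolding eq
    using f by (simp add: class_coeff_ae_class mult_pow_square_integrable lcoeff_mult_pow)
qed

text \<open>
  The adjoint is a definite description, so this needs existence as well as uniqueness; two candidates
  have the same inner products with all monomials.
\<close>

lemma bergman_space_adjoint:
  assumes G: "G \<in> H"
  shows "l2_adjoint M H (mult_pow r n) G \<in> H"
    and "class_coeff (l2_adjoint M H (mult_pow r n) G) j = class_coeff G (j + int n) * of_real (eigval n j)"
proof -
  obtain g where g: "g \<in> bergman" "g \<in> square_integrable M" "G = ae_class M g"
    using G by (rule bergman_spaceE)
  obtain k where k: "k \<in> bergman" "\<And>j. lcoeff k j = lcoeff g (j + int n) * of_real (eigval n j)"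
    "\<And>f. f \<in> bergman \<Longrightarrow> fun_inner M (\<lambda>z. z ^ n * f z) g = fun_inner M f k" using adjoint_exists[OF g(1)] by blast
  have ks: "k \<in> square_integrable M" by (rule bergman_square_integrable[OF k(1)])
  let ?K = "ae_class M k"
  have KH: "?K \<in> H" by (rule ae_class_in_bergman_space[OF k(1)])
  have adj: "l2_inner M (mult_pow r n F) G = l2_inner M F ?K" if FH: "F \<in> H" for F
  proof -
    obtain f where f: "f \<in> bergman" "f \<in> square_integrable M" "F = ae_class M f"
      using FH by (rule bergman_spaceE)
    have TF: "mult_pow r n F = ae_class M (\<lambda>z. z ^ n * f z)"
      unfolding mult_pow_def f(3) by (rule l2_mult_ae_class[OF f(2)])
    show ?thesis
      unfolding TF unfolding f(3) g(3)
        l2_inner_eq_fun_inner[OF mult_pow_square_integrable[OF f(2)] g(2)] l2_inner_eq_fun_inner[OF f(2) ks]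
      by (rule k(3)[OF f(1)])
  qed
  have "l2_adjoint M H (mult_pow r n) G = ?K" unfolding l2_adjoint_def
  proof (rule the_equality)
    show "?K \<in> H \<and> (\<forall>F\<in>H. l2_inner M (mult_pow r n F) G = l2_inner M F ?K)"
      using KH adj by blast
    fix P assume P: "P \<in> H \<and> (\<forall>F\<in>H. l2_inner M (mult_pow r n F) G = l2_inner M F P)"
    from conjunct1[OF P] obtain p
      where p: "p \<in> bergman" "p \<in> square_integrable M" "P = ae_class M p" by (rule bergman_spaceE)
    show "P = ?K"
    proof (rule bergman_space_eqI)
      fix j
      have "l2_inner M (zclass j) P = l2_inner M (mult_pow r n (zclass j)) G" using P zclass_in_bergman_space[of j] by simp
      also have "\<dots> = l2_inner M (zclass j) ?K" by (rule adj[OF zclass_in_bergman_space])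
      finally have "l2_inner M (zclass j) P = l2_inner M (zclass j) ?K" .
      then have "fun_inner M (zpow j) p = fun_inner M (zpow j) k" using p ks by (simp add: zclass_def l2_inner_eq_fun_inner)
      then have "fun_inner M p (zpow j) = fun_inner M k (zpow j)"
        by (simp flip: cnj_fun_inner[of M "zpow j"])
      then show "class_coeff P j = class_coeff ?K j" using p ks by (simp add: class_coeff_ae_class lcoeff_def)
    qed (use P KH in auto)
  qed
  then show "l2_adjoint M H (mult_pow r n) G \<in> H"
    and "class_coeff (l2_adjoint M H (mult_pow r n) G) j = class_coeff G (j + int n) * of_real (eigval n j)"
    using KH g ks k(2) by (simp_all add: class_coeff_ae_class)
qed

section \<open>Closed spans of monomials\<close>

text \<open>
  The closed linear span of the monomials with exponents in \<open>J\<close> (\<open>monomial_span_eq_hull\<close>), given through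
  vanishing coefficients because these behave well under \<open>T\<close> and its adjoint.
\<close>

definition monomial_span :: "int set \<Rightarrow> complex l2 set" where
  "monomial_span J = {F \<in> H. \<forall>m. m \<notin> J \<longrightarrow> class_coeff F m = 0}"

lemma zclass_in_monomial_span_iff: "zclass m \<in> monomial_span J \<longleftrightarrow> m \<in> J"
  by (auto simp: monomial_span_def zclass_in_bergman_space class_coeff_zclass)

lemma monomial_span_subset_iff: "monomial_span J \<subseteq> monomial_span J' \<longleftrightarrow> J \<subseteq> J'"
proof
  show "J \<subseteq> J'" if "monomial_span J \<subseteq> monomial_span J'" using that zclass_in_monomial_span_iff by blast
qed (auto simp: monomial_span_def)

lemma monomial_span_empty: "monomial_span {} = {l2_zero M}"
proof
  show "monomial_span {} \<subseteq> {l2_zero M}"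
  proof
    fix F assume "F \<in> monomial_span {}"
    then have "F = l2_zero M" by (intro bergman_space_eqI bergman_space_zero) (auto simp: monomial_span_def class_coeff_zero)
    then show "F \<in> {l2_zero M}" by simp
  qed
qed (simp add: monomial_span_def bergman_space_zero class_coeff_zero)

text \<open>
  Closedness holds because a single coefficient is continuous, by \<open>class_coeff_dist_le\<close>.
\<close>

lemma monomial_span_closed_subspace: "l2_closed_subspace M (monomial_span J)"
  unfolding l2_closed_subspace_def
proof (intro conjI ballI allI)
  show L: "monomial_span J \<subseteq> L2 M" using bergman_space_subset_L2 by (auto simp: monomial_span_def)
  show "l2_zero M \<in> monomial_span J" by (simp add: monomial_span_def bergman_space_zero class_coeff_zero)
  show "l2_add M F G \<in> monomial_span J" if "F \<in> monomial_span J" "G \<in> monomial_span J" for F G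
    using that by (simp add: monomial_span_def bergman_space_add)
  show "l2_scale M c F \<in> monomial_span J" if "F \<in> monomial_span J" for c F
    using that by (simp add: monomial_span_def bergman_space_scale)
  show "l2_closure M (monomial_span J) = monomial_span J"
  proof
    show "monomial_span J \<subseteq> l2_closure M (monomial_span J)" by (rule subset_l2_closure[OF L])
    show "l2_closure M (monomial_span J) \<subseteq> monomial_span J"
    proof
      fix F assume F: "F \<in> l2_closure M (monomial_span J)"
      have FH: "F \<in> H"
        using F l2_closure_mono[of "monomial_span J" H M] bergman_space_closed by (auto simp: monomial_span_def)
      have "class_coeff F m = 0" if m: "m \<notin> J" for m
      proof (rule ccontr)
        assume "class_coeff F m \<noteq> 0"
        then have pos: "(cmod (class_coeff F m))\<^sup>2 * \<omega> m > 0" using \<omega>_pos by simp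
        then have "sqrt ((cmod (class_coeff F m))\<^sup>2 * \<omega> m) > 0" by (rule real_sqrt_gt_zero)
        then obtain G where G: "G \<in> monomial_span J" "l2_dist M F G < sqrt ((cmod (class_coeff F m))\<^sup>2 * \<omega> m)"
          using F unfolding l2_closure_def by blast
        have "l2_dist M F G \<ge> 0" by (simp add: l2_dist_def)
        then have "(l2_dist M F G)\<^sup>2 < (sqrt ((cmod (class_coeff F m))\<^sup>2 * \<omega> m))\<^sup>2"
          using G(2) by (intro power_strict_mono) auto
        also have "\<dots> = (cmod (class_coeff F m - class_coeff G m))\<^sup>2 * \<omega> m"
          using pos G(1) m by (simp add: monomial_span_def)
        also have "\<dots> \<le> (l2_dist M F G)\<^sup>2"
          using FH G(1) by (intro class_coeff_dist_le) (auto simp: monomial_span_def)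
        finally show False by simp
      qed
      then show "F \<in> monomial_span J" using FH by (simp add: monomial_span_def)
    qed
  qed
qed

lemma laurent_sum_in_subspace:
  assumes S: "l2_closed_subspace M S" and "finite X" and "\<And>j. j \<in> X \<Longrightarrow> c j \<noteq> 0 \<Longrightarrow> zclass j \<in> S"
  shows "ae_class M (laurent_sum X c) \<in> S"
  using assms(2,3)
proof (induction X rule: finite_induct)
  case empty
  then show ?case using S by (simp add: laurent_sum_def[abs_def] l2_closed_subspace_def l2_zero_def)
next
  case (insert j X)
  then have IH: "ae_class M (laurent_sum X c) \<in> S" by simp
  have eq: "laurent_sum (insert j X) c = (\<lambda>z. c j * zpow j z + laurent_sum X c z)"
    using insert.hyps by (simp add: laurent_sum_def[abs_def])
  show ?case
  proof (cases "c j = 0")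
    case True
    then show ?thesis using IH by (simp add: eq)
  next
    case False
    then have "l2_add M (l2_scale M (c j) (zclass j)) (ae_class M (laurent_sum X c)) \<in> S"
      using S IH insert.prems by (simp add: l2_closed_subspace_def)
    then show ?thesis
      using insert.hyps
      by (simp add: eq zclass_def l2_scale_ae_class l2_add_ae_class square_integrable_scale)
  qed
qed

text \<open>
  The partial sums of an element of the span lie in every closed subspace with these monomials.
\<close>

lemma monomial_span_least:
  assumes S: "l2_closed_subspace M S" and J: "\<And>m. m \<in> J \<Longrightarrow> zclass m \<in> S"
  shows "monomial_span J \<subseteq> S"
proof
  fix F assume F: "F \<in> monomial_span J"
  then have "F \<in> H" by (simp add: monomial_span_def)
  then obtain f where f: "f \<in> bergman" "f \<in> square_integrable M" "F = ae_class M f"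
    by (rule bergman_spaceE)
  have "F \<in> l2_closure M S" unfolding l2_closure_def
  proof (intro CollectI conjI allI impI)
    show "F \<in> L2 M" using f by (simp add: ae_class_in_L2)
    fix e :: real assume "e > 0"
    then obtain X where X: "finite X" "fun_norm M (\<lambda>z. f z - laurent_sum X (lcoeff f) z) < e"
      using bergman_partial_sums[OF f(1)] by (metis order_refl)
    have "ae_class M (laurent_sum X (lcoeff f)) \<in> S"
    proof (rule laurent_sum_in_subspace[OF S X(1)])
      fix j assume "lcoeff f j \<noteq> 0"
      then have "class_coeff F j \<noteq> 0" using f by (simp add: class_coeff_ae_class)
      then show "zclass j \<in> S" using F J by (auto simp: monomial_span_def)
    qed
    then show "\<exists>G\<in>S. l2_dist M F G < e"
      using X f(2,3) by (intro bexI[of _ "ae_class M (laurent_sum X (lcoeff f))"]) (simp_all add: l2_dist_eq_fun_norm)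
  qed
  then show "F \<in> S" using S by (simp add: l2_closed_subspace_def)
qed

lemma monomial_span_eq_hull: "monomial_span J = l2_closed_subspace M hull (zclass ` J)"
  by (rule hull_unique[symmetric])
     (auto simp: zclass_in_monomial_span_iff monomial_span_closed_subspace monomial_span_least image_subset_iff intro: subsetD[OF monomial_span_least])

section \<open>Reducing subspaces\<close>

lemma scale_in_subspace_cancel:
  assumes S: "l2_closed_subspace M S" and "c \<noteq> 0" "F \<in> H" "l2_scale M c F \<in> S"
  shows "F \<in> S"
proof -
  have "l2_scale M (1 / c) (l2_scale M c F) \<in> S"
    using S assms(4) by (simp add: l2_closed_subspace_def)
  moreover have "l2_scale M (1 / c) (l2_scale M c F) = F"
    using assms by (intro bergman_space_eqI) (auto simp: bergman_space_scale)
  ultimately show ?thesis by simp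
qed

text \<open>
  Powers of a function of \<open>T\<^sup>* T\<close> isolate the component of \<open>F\<close> at \<open>z\<^sup>m\<close>. In the proof \<open>D\<close> is \<open>T\<^sup>* T - \<lambda> m\<close> and
  \<open>B\<close> is \<open>1 - D\<^sup>2\<close>, with the eigenvalue \<open>b j\<close> at \<open>z\<^sup>j\<close>. All \<open>\<lambda> j\<close> lie in \<open>(0, 1]\<close> and are distinct, so \<open>b j\<close> is
  \<open>1\<close> for \<open>j = m\<close> and lies strictly between \<open>0\<close> and \<open>1\<close> otherwise.
\<close>

lemma reducing_contains_monomial:
  assumes R: "reducing_subspace M H (mult_pow r n) S" and n: "n > 0"
    and F: "F \<in> S" and m: "class_coeff F m \<noteq> 0"
  shows "zclass m \<in> S"
proof -
  have S: "l2_closed_subspace M S" and SH: "S \<subseteq> H"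
    and T: "\<And>G. G \<in> S \<Longrightarrow> mult_pow r n G \<in> S"
    and T': "\<And>G. G \<in> S \<Longrightarrow> l2_adjoint M H (mult_pow r n) G \<in> S"
    using R by (auto simp: reducing_subspace_def)
  have add: "\<And>G P. G \<in> S \<Longrightarrow> P \<in> S \<Longrightarrow> l2_add M G P \<in> S"
    and scale: "\<And>c G. G \<in> S \<Longrightarrow> l2_scale M c G \<in> S"
    and closed: "l2_closure M S = S" using S by (auto simp: l2_closed_subspace_def)
  define D where "D G = l2_add M (l2_adjoint M H (mult_pow r n) (mult_pow r n G))
      (l2_scale M (- of_real (eigval n m)) G)" for G
  have D: "D G \<in> S" "class_coeff (D G) j = of_real (eigval n j - eigval n m) * class_coeff G j" if "G \<in> S" for G j
  proof -
    have GH: "G \<in> H" using that SH by blast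
    show "D G \<in> S" unfolding D_def by (intro add scale T T' that)
    show "class_coeff (D G) j = of_real (eigval n j - eigval n m) * class_coeff G j"
      unfolding D_def using GH by (simp add: bergman_space_add bergman_space_scale bergman_space_adjoint bergman_space_mult_pow algebra_simps)
  qed
  define B where "B G = l2_add M G (l2_scale M (-1) (D (D G)))" for G
  define b where "b j = 1 - (eigval n j - eigval n m)\<^sup>2" for j
  have B: "B G \<in> S" "class_coeff (B G) j = of_real (b j) * class_coeff G j" if "G \<in> S" for G j
  proof -
    have GH: "G \<in> H" "D (D G) \<in> H" using that SH D(1) by blast+
    show "B G \<in> S" unfolding B_def by (intro add scale D that)
    show "class_coeff (B G) j = of_real (b j) * class_coeff G j"
      unfolding B_def using GH that by (simp add: bergman_space_add bergman_space_scale D b_def power2_eq_square algebra_simps)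
  qed
  have BN: "(B ^^ N) F \<in> S \<and> (\<forall>j. class_coeff ((B ^^ N) F) j = of_real (b j ^ N) * class_coeff F j)" for N
    by (induction N) (auto simp: F B mult_ac)
  let ?P = "l2_scale M (class_coeff F m) (zclass m)"
  have PH: "?P \<in> H" by (intro bergman_space_scale zclass_in_bergman_space)
  have cfP: "class_coeff ?P j = (if j = m then class_coeff F m else 0)" for j
    by (simp add: bergman_space_scale zclass_in_bergman_space class_coeff_zclass)
  have FH: "F \<in> H" using F SH by blast
  have eigval_diff: "\<bar>eigval n j - eigval n m\<bar> < 1" for j
    using eigval_bounds[of n j] eigval_bounds[of n m] by linarith
  have b: "0 < b j" "b j \<le> 1" "j \<noteq> m \<Longrightarrow> b j < 1" for j
  proof -
    show "0 < b j" using eigval_diff[of j] by (simp add: b_def abs_square_less_1)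
    show "b j \<le> 1" by (simp add: b_def)
    show "b j < 1" if "j \<noteq> m" using eigval_inj[OF n, of j m] that by (auto simp: b_def)
  qed
  let ?g = "\<lambda>j. (cmod (class_coeff F j - class_coeff ?P j))\<^sup>2 * \<omega> j"
  have "?P \<in> l2_closure M S" unfolding l2_closure_def
  proof (intro CollectI conjI allI impI)
    show "?P \<in> L2 M" using PH bergman_space_subset_L2 by blast
    fix e :: real assume e: "e > 0"
    have "\<exists>N. \<forall>t. ((\<lambda>j. (b j)\<^sup>2 ^ N * ?g j) has_sum t) UNIV \<longrightarrow> t < e\<^sup>2"
    proof (rule damped_has_sum_less[OF bergman_space_parseval[OF FH PH]])
      show "(b j)\<^sup>2 < 1" if "?g j \<noteq> 0" for j
      proof -
        have "j \<noteq> m" using that by (auto simp: cfP)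
        then show ?thesis using b[of j] by (simp add: abs_square_less_1)
      qed
      show "(b j)\<^sup>2 \<le> 1" for j using b[of j] by (simp add: abs_square_le_1)
    qed (use e in auto)
    then obtain N where "\<forall>t. ((\<lambda>j. (b j)\<^sup>2 ^ N * ?g j) has_sum t) UNIV \<longrightarrow> t < e\<^sup>2"
      by (rule exE)
    note N = this[rule_format]
    let ?G = "(B ^^ N) F"
    have G: "?G \<in> S" "?G \<in> H" using BN SH by blast+
    have eq: "(cmod (class_coeff ?P j - class_coeff ?G j))\<^sup>2 * \<omega> j = (b j)\<^sup>2 ^ N * ?g j" for j
    proof (cases "j = m")
      case True
      have "b m = 1" by (simp add: b_def)
      then show ?thesis using True BN[of N] by (simp add: cfP)
    next
      case False
      have "(b j ^ N)\<^sup>2 = (b j)\<^sup>2 ^ N" by (simp add: mult.commute flip: power_mult)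
      then show ?thesis using False BN[of N] b(1)[of j]
        by (simp add: cfP norm_mult norm_power power_mult_distrib del: of_real_power)
    qed
    have "((\<lambda>j. (b j)\<^sup>2 ^ N * ?g j) has_sum (l2_dist M ?P ?G)\<^sup>2) UNIV"
      by (rule has_sum_cong[THEN iffD1, OF eq bergman_space_parseval[OF PH G(2)]])
    then have "(l2_dist M ?P ?G)\<^sup>2 < e\<^sup>2" by (rule N)
    then have "l2_dist M ?P ?G < e" by (rule power2_less_imp_less) (use e in simp)
    then show "\<exists>G\<in>S. l2_dist M ?P G < e" using G(1) by (rule bexI)
  qed
  then have "?P \<in> S" using closed by simp
  then show ?thesis using scale_in_subspace_cancel[OF S m zclass_in_bergman_space] by blast
qed

definition periodic :: "nat \<Rightarrow> int set \<Rightarrow> bool" where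
  "periodic n J \<longleftrightarrow> (\<forall>m. m + int n \<in> J \<longleftrightarrow> m \<in> J)"

lemma monomial_span_reducing:
  assumes "periodic n J" shows "reducing_subspace M H (mult_pow r n) (monomial_span J)"
  unfolding reducing_subspace_def
proof (intro conjI ballI monomial_span_closed_subspace)
  show "monomial_span J \<subseteq> H" by (auto simp: monomial_span_def)
  have per: "m + int n \<in> J \<longleftrightarrow> m \<in> J" for m using assms by (simp add: periodic_def)
  have per': "m - int n \<in> J \<longleftrightarrow> m \<in> J" for m using per[of "m - int n"] by simp
  show "mult_pow r n F \<in> monomial_span J" if "F \<in> monomial_span J" for F
    using that by (simp add: monomial_span_def bergman_space_mult_pow per')
  show "l2_adjoint M H (mult_pow r n) F \<in> monomial_span J" if "F \<in> monomial_span J" for F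
    using that by (simp add: monomial_span_def bergman_space_adjoint per)
qed

text \<open>
  \<open>T\<close> sends the monomial \<open>z\<^sup>m\<close> to \<open>z\<^bsup>m+n\<^esup>\<close>, and the adjoint sends \<open>z\<^bsup>m+n\<^esup>\<close> to a nonzero multiple of \<open>z\<^sup>m\<close>; this
  makes the exponents periodic.
\<close>

lemma reducing_imp_monomial_span:
  assumes R: "reducing_subspace M H (mult_pow r n) S" and n: "n > 0"
  shows "periodic n {m. zclass m \<in> S} \<and> S = monomial_span {m. zclass m \<in> S}"
proof
  have S: "l2_closed_subspace M S" and SH: "S \<subseteq> H"
    and T: "\<And>G. G \<in> S \<Longrightarrow> mult_pow r n G \<in> S"
    and T': "\<And>G. G \<in> S \<Longrightarrow> l2_adjoint M H (mult_pow r n) G \<in> S"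
    using R by (auto simp: reducing_subspace_def)
  have TE: "mult_pow r n (zclass m) = zclass (m + int n)" for m
    by (rule bergman_space_eqI) (auto simp: bergman_space_mult_pow zclass_in_bergman_space class_coeff_zclass)
  have T'E: "l2_adjoint M H (mult_pow r n) (zclass (m + int n)) = l2_scale M (of_real (eigval n m)) (zclass m)" for m
    by (rule bergman_space_eqI) (auto simp: bergman_space_adjoint bergman_space_scale zclass_in_bergman_space class_coeff_zclass)
  show "periodic n {m. zclass m \<in> S}" unfolding periodic_def
  proof (intro allI iffI; simp)
    fix m
    show "zclass (m + int n) \<in> S" if "zclass m \<in> S" using T[OF that] by (simp add: TE)
    show "zclass m \<in> S" if "zclass (m + int n) \<in> S"
    proof (rule scale_in_subspace_cancel[OF S _ zclass_in_bergman_space])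
      show "l2_scale M (of_real (eigval n m)) (zclass m) \<in> S" using T'[OF that] by (simp add: T'E)
      show "complex_of_real (eigval n m) \<noteq> 0" using eigval_bounds[of n m] by simp
    qed
  qed
  show "S = monomial_span {m. zclass m \<in> S}"
  proof
    show "S \<subseteq> monomial_span {m. zclass m \<in> S}"
      using reducing_contains_monomial[OF R n] SH by (auto simp: monomial_span_def)
    show "monomial_span {m. zclass m \<in> S} \<subseteq> S" by (rule monomial_span_least[OF S]) simp
  qed
qed

section \<open>Unions of residue classes\<close>

definition residues_in :: "nat \<Rightarrow> nat set \<Rightarrow> int set" where
  "residues_in n A = {m. nat (m mod int n) \<in> A}"

lemma periodic_residues_in: "periodic n (residues_in n A)"
  by (simp add: periodic_def residues_in_def)

lemma periodic_imp_residues_in: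
  assumes J: "periodic n J" and n: "n > 0"
  shows "J = residues_in n {k. k < n \<and> int k \<in> J}"
proof -
  have step: "m + int n * k \<in> J \<longleftrightarrow> m \<in> J" for m k
  proof (induction k rule: int_induct[where k = 0])
    case base show ?case by simp
  next
    case (step1 i)
    then show ?case using J[unfolded periodic_def, rule_format, of "m + int n * i"]
      by (simp add: algebra_simps)
  next
    case (step2 i)
    then show ?case using J[unfolded periodic_def, rule_format, of "m + int n * (i - 1)"]
      by (simp add: algebra_simps)
  qed
  have "m mod int n \<in> J \<longleftrightarrow> m \<in> J" for m
    using step[of "m mod int n" "m div int n"] by simp
  then show ?thesis using n by (auto simp: residues_in_def nat_less_iff)
qed

lemma residues_in_subset_iff:
  assumes "A \<subseteq> {..<n}" shows "residues_in n A \<subseteq> residues_in n B \<longleftrightarrow> A \<subseteq> B"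
proof
  assume sub: "residues_in n A \<subseteq> residues_in n B"
  show "A \<subseteq> B"
  proof
    fix k assume "k \<in> A"
    then have "int k \<in> residues_in n A" "k < n" using assms by (auto simp: residues_in_def)
    then have "int k \<in> residues_in n B" "k < n" using sub by auto
    then show "k \<in> B" by (simp add: residues_in_def)
  qed
qed (auto simp: residues_in_def)

text \<open>
  For \<open>A \<subseteq> {0..<n}\<close> this is the closed sum of the spaces \<open>residue_subspace r n k\<close> over \<open>k \<in> A\<close>; see
  \<open>residue_subspace_eq\<close> for a single \<open>k\<close>.
\<close>

definition residue_sum :: "nat \<Rightarrow> nat set \<Rightarrow> complex l2 set" where
  "residue_sum n A = monomial_span (residues_in n A)"

lemma residue_sum_subset_iff: "A \<subseteq> {..<n} \<Longrightarrow> residue_sum n A \<subseteq> residue_sum n B \<longleftrightarrow> A \<subseteq> B"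
  by (simp add: residue_sum_def monomial_span_subset_iff residues_in_subset_iff)

lemma residue_sum_inj: "inj_on (residue_sum n) (Pow {..<n})"
  by (rule inj_onI) (metis PowD residue_sum_subset_iff subset_antisym order_refl)

lemma residue_sum_empty: "residue_sum n {} = {l2_zero M}"
  by (simp add: residue_sum_def residues_in_def monomial_span_empty)

lemma reducing_subspaces:
  assumes n: "n > 0"
  shows "{S. reducing_subspace M H (mult_pow r n) S} = residue_sum n ` Pow {..<n}"
proof (intro subset_antisym subsetI CollectI)
  fix S assume "S \<in> {S. reducing_subspace M H (mult_pow r n) S}"
  then have "periodic n {m. zclass m \<in> S}" and S: "S = monomial_span {m. zclass m \<in> S}"
    using reducing_imp_monomial_span[OF _ n] by blast+
  then have "S = residue_sum n {k. k < n \<and> int k \<in> {m. zclass m \<in> S}}"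
    unfolding residue_sum_def by (simp only: periodic_imp_residues_in[OF _ n, symmetric])
  then show "S \<in> residue_sum n ` Pow {..<n}" by (rule image_eqI) auto
qed (auto simp: residue_sum_def monomial_span_reducing periodic_residues_in)

lemma residue_subspace_eq:
  assumes "k < n" shows "residue_subspace r n k = residue_sum n {k}"
proof -
  have "m \<in> residues_in n {k} \<longleftrightarrow> [m = int k] (mod int n)" for m
  proof -
    have "int k mod int n = int k" "0 \<le> m mod int n" using assms by auto
    then show ?thesis by (auto simp: residues_in_def cong_def)
  qed
  then have "residues_in n {k} = {m. [m = int k] (mod int n)}" by blast
  then have "{ae_class M (\<lambda>z. z powi m) |m::int. [m = int k] (mod int n)} = zclass ` residues_in n {k}"
    by (simp only: zclass_def zpow_def[abs_def] image_Collect)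
  then show ?thesis
    unfolding residue_subspace_def residue_sum_def monomial_span_eq_hull by (simp only:)
qed

lemma minimal_reducing_iff:
  assumes n: "n > 0"
  shows "minimal_reducing_subspace M H (mult_pow r n) S \<longleftrightarrow> (\<exists>k<n. S = residue_sum n {k})"
proof
  have red: "reducing_subspace M H (mult_pow r n) (residue_sum n A)" if "A \<subseteq> {..<n}" for A
  proof -
    have "residue_sum n A \<in> residue_sum n ` Pow {..<n}" by (rule imageI) (use that in simp)
    then show ?thesis unfolding reducing_subspaces[OF n, symmetric] by simp
  qed
  have red_E: "\<exists>A. A \<subseteq> {..<n} \<and> R = residue_sum n A"
    if "reducing_subspace M H (mult_pow r n) R" for R
  proof -
    have "R \<in> residue_sum n ` Pow {..<n}"
      unfolding reducing_subspaces[OF n, symmetric] using that by simp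
    then show ?thesis by auto
  qed
  have nonzero: "residue_sum n {k} \<noteq> {l2_zero M}" if "k < n" for k
    using residue_sum_subset_iff[of "{k}" n "{}"] that by (simp add: residue_sum_empty)
  {
    assume S: "minimal_reducing_subspace M H (mult_pow r n) S"
    then obtain A where A: "A \<subseteq> {..<n}" "S = residue_sum n A"
      using red_E unfolding minimal_reducing_subspace_def by meson
    have "A \<noteq> {}"
      using S A(2) residue_sum_empty unfolding minimal_reducing_subspace_def by metis
    then obtain k where "k \<in> A" by auto
    then have k: "k < n" "{k} \<subseteq> {..<n}" "{k} \<subseteq> A" using A(1) by auto
    then have "residue_sum n {k} \<subseteq> S" by (simp only: A(2) residue_sum_subset_iff)
    then have "residue_sum n {k} = S"
      using S red[OF k(2)] nonzero[OF k(1)] unfolding minimal_reducing_subspace_def by metis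
    then show "\<exists>k<n. S = residue_sum n {k}" using k(1) by auto
  next
    assume "\<exists>k<n. S = residue_sum n {k}"
    then obtain k where k: "k < n" "S = residue_sum n {k}" by auto
    show "minimal_reducing_subspace M H (mult_pow r n) S"
      unfolding minimal_reducing_subspace_def
    proof (intro conjI allI impI)
      show "reducing_subspace M H (mult_pow r n) S" unfolding k(2) by (rule red) (use k(1) in simp)
      show "S \<noteq> {l2_zero M}" unfolding k(2) by (rule nonzero[OF k(1)])
      fix R assume R: "reducing_subspace M H (mult_pow r n) R \<and> R \<subseteq> S"
      then obtain B where B: "B \<subseteq> {..<n}" "R = residue_sum n B" using red_E by meson
      then have "B \<subseteq> {k}" using R residue_sum_subset_iff[OF B(1)] unfolding k(2) by simp
      then have "B = {} \<or> B = {k}" by (simp add: subset_singleton_iff)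
      then show "R = {l2_zero M} \<or> R = S" unfolding B(2) k(2) by (elim disjE) (simp_all add: residue_sum_empty)
    qed
  }
qed

lemma card_reducing_subspaces:
  assumes n: "n > 0"
  shows "card {S. reducing_subspace M H (mult_pow r n) S} = 2 ^ n"
  unfolding reducing_subspaces[OF n] by (simp add: card_image[OF residue_sum_inj] card_Pow)

lemma minimal_reducing_subspaces:
  assumes n: "n > 0"
  shows "{S. minimal_reducing_subspace M H (mult_pow r n) S} = {residue_subspace r n k |k. k < n}"
  unfolding minimal_reducing_iff[OF n] using residue_subspace_eq by auto

end

section \<open>The lattice of reducing subspaces\<close>

theorem theorem6:
  fixes r :: real and n :: nat
  assumes "0 < r" and "r < 1" and "n \<ge> 2"
  shows "card {S. reducing_subspace (annulus_measure r) (bergman_space r) (mult_pow r n) S} = 2 ^ n \<and>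
         {S. minimal_reducing_subspace (annulus_measure r) (bergman_space r) (mult_pow r n) S}
           = {residue_subspace r n k |k. k < n}"
proof -
  have r: "annulus_radius r" using assms(1,2) by (rule annulus_radius.intro)
  have n: "n > 0" using assms(3) by linarith
  show ?thesis
    by (rule conjI[OF annulus_radius.card_reducing_subspaces[OF r n]
          annulus_radius.minimal_reducing_subspaces[OF r n]])
qed

end
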